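(* For every $n\in\mathbb{N}=\{0,1,2,\dots\}$ and every $a\in\mathbb{D}$ one has $\mathrm{M_F}(k_{n,a})=\mathrm{M_F}(e_{n,a})=n$. Moreover, for every $n\ge 1$ and every $n$-tuple $(a_1,\dots,a_n)$ of points of $\mathbb{D}$ (repetitions allowed), the $n$-th Takenaka–Malmquist function $$B_n(z)=\frac{\sqrt{1-|a_n|^2}}{1-\overline{a_n}z}\prod_{l=1}^{n-1}\frac{z-a_l}{1-\overline{a_l}z}$$ satisfies $\mathrm{M_F}(B_n)=n-1$.
   Context: $\mathbb{D}$ is the open unit disc and $H^2(\mathbb{D})$ the Hardy space of the disc. For $a\in\mathbb{D}$, $k_a(z)=\frac{1}{1-\overline{a}z}$ is the Szegő kernel; the multiple Szegő kernels are $k_{n,a}(z)=\left(\frac{\partial}{\partial\overline{a}}\right)^n k_a(z)=\frac{n!\,z^n}{(1-\overline{a}z)^{n+1}}$, and $e_{n,a}=k_{n,a}/\|k_{n,a}\|_{H^2}$. Mean-frequency: every $f\in H^2(\mathbb{D})$, $f\not\equiv 0$, factors (uniquely up to unimodular constants) as $f=\phi\, s\, o$ with $\phi$ a Blaschke product, $s$ a singular inner function and $o$ an outer function; on the boundary, a.e., $\phi(e^{it})=e^{i\theta_\phi(t)}$ and $s(e^{it})=e^{i\theta_s(t)}$ with real phase functions $\theta_\phi,\theta_s$. The mean-frequency of $f$ is $\mathrm{M_F}(f)=\frac{1}{2\pi}\left(\int_0^{2\pi}\theta_\phi'(t)\,dt+\int_0^{2\pi}\theta_s'(t)\,dt\right)$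 (so that, e.g., $\mathrm{M_F}(z^n)=n$ and the mean-frequency of a Möbius factor $\frac{z-a}{1-\overline{a}z}$ equals $1$, and outer functions have mean-frequency $0$). *)

theory Defs
  imports "HOL-Analysis.Analysis"
begin

definition hardy2_norm :: "(complex \<Rightarrow> complex) \<Rightarrow> real" where
  "hardy2_norm f = sqrt (SUP r\<in>{0<..<1::real}.
      (1 / (2*pi)) * (LINT t:{0..2*pi}|lborel. (cmod (f (of_real r * cis t)))\<^sup>2))"

definition szego_kernel :: "nat \<Rightarrow> complex \<Rightarrow> complex \<Rightarrow> complex" where
  "szego_kernel n a z = of_nat (fact n) * z ^ n / (1 - cnj a * z) ^ (n + 1)"

definition szego_normalized :: "nat \<Rightarrow> complex \<Rightarrow> complex \<Rightarrow> complex" where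
  "szego_normalized n a z = szego_kernel n a z / of_real (hardy2_norm (szego_kernel n a))"

definition TM :: "nat \<Rightarrow> (nat \<Rightarrow> complex) \<Rightarrow> complex \<Rightarrow> complex" where
  "TM n a z = of_real (sqrt (1 - (cmod (a n))\<^sup>2)) / (1 - cnj (a n) * z)
              * (\<Prod>l\<in>{1..<n}. (z - a l) / (1 - cnj (a l) * z))"

definition blaschke_factor :: "complex \<Rightarrow> complex \<Rightarrow> complex" where
  "blaschke_factor a z = (if a = 0 then z else
      (of_real (cmod a) / a) * (a - z) / (1 - cnj a * z))"

definition blaschke_product :: "(complex \<Rightarrow> complex) \<Rightarrow> bool" where
  "blaschke_product \<phi> \<longleftrightarrow> (\<exists>c a. cmod c = 1 \<and> (\<forall>k. a k \<in> ball 0 1) \<and>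
     ((\<exists>n::nat. \<forall>z\<in>ball 0 1. \<phi> z = c * (\<Prod>k<n. blaschke_factor (a k) z)) \<or>
      (summable (\<lambda>k. 1 - cmod (a k)) \<and>
       (\<forall>z\<in>ball 0 1. (\<lambda>k. blaschke_factor (a k) z) has_prod (\<phi> z / c)))))"

definition singular_inner :: "(complex \<Rightarrow> complex) \<Rightarrow> bool" where
  "singular_inner s \<longleftrightarrow> (\<exists>c (\<mu>::real measure). cmod c = 1 \<and>
     sets \<mu> = sets borel \<and> finite_measure \<mu> \<and> emeasure \<mu> (UNIV - {0..<2*pi}) = 0 \<and>
     (\<exists>N\<in>sets borel. emeasure lborel N = 0 \<and> emeasure \<mu> (UNIV - N) = 0) \<and>
     (\<forall>z\<in>ball 0 1. s z = c * exp (- integral\<^sup>L \<mu> (\<lambda>t. (cis t + z) / (cis t - z)))))"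

text \<open>Outer functions: unimodular constant times exp of the Herglotz integral of an
  integrable real function (the log of the boundary modulus).\<close>
definition outer_fun :: "(complex \<Rightarrow> complex) \<Rightarrow> bool" where
  "outer_fun g \<longleftrightarrow> (\<exists>c (h::real \<Rightarrow> real). cmod c = 1 \<and> set_integrable lborel {0..2*pi} h \<and>
     (\<forall>z\<in>ball 0 1. g z = c * exp ((1 / (2*pi)) *
         (LINT t:{0..2*pi}|lborel. (cis t + z) / (cis t - z) * of_real (h t)))))"

definition is_phase :: "(complex \<Rightarrow> complex) \<Rightarrow> (real \<Rightarrow> real) \<Rightarrow> bool" where
  "is_phase g \<theta> \<longleftrightarrow>
     (AE t in lborel. t \<in> {0..2*pi} \<longrightarrow>
        ((\<lambda>r. g (of_real r * cis t)) \<longlongrightarrow> cis (\<theta> t)) (at_left 1)) \<and>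
     (AE t in lborel. t \<in> {0..2*pi} \<longrightarrow> \<theta> differentiable (at t))"

definition phase_freq :: "(complex \<Rightarrow> complex) \<Rightarrow> real" where
  "phase_freq g = (THE m. \<exists>\<theta>. is_phase g \<theta> \<and> set_integrable lborel {0..2*pi} (deriv \<theta>) \<and>
       m = (LINT t:{0..2*pi}|lborel. deriv \<theta> t) / (2*pi))"

definition mean_freq :: "(complex \<Rightarrow> complex) \<Rightarrow> real" where
  "mean_freq f = (THE m. \<exists>\<phi> s u. blaschke_product \<phi> \<and> singular_inner s \<and> outer_fun u \<and>
       (\<forall>z\<in>ball 0 1. f z = \<phi> z * s z * u z) \<and> m = phase_freq \<phi> + phase_freq s)"

end

theory Submission
  imports Defs "HOL-Complex_Analysis.Complex_Analysis"
begin

text \<open>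
  Each function in question is a finite Blaschke product times an outer function, so it suffices
  to show that such a product has as mean-frequency the number of Blaschke factors, whichever
  factorization is used to compute it.

  A phase with an integrable derivative determines that derivative almost everywhere: two phases
  differ almost everywhere by multiples of \<open>2\<pi>\<close>, and a difference quotient taken along such points
  vanishes wherever both are differentiable. A Blaschke factor has on the circle the phase
  \<open>t - 2 Im (Ln (1 - cnj a * cis t))\<close> up to a constant, which increases by \<open>2\<pi>\<close>.

  Comparing zeros, any two factorizations have the same Blaschke factors, and what remains is that
  a singular inner function \<open>s\<close> which is also outer is constant. Equating the two exponential
  representations of \<open>s\<close> gives a constant Herglotz integral, hence all Fourier
  coefficients of \<open>\<mu> + w dt\<close> vanish, where \<open>\<mu>\<close> is the singular measure and \<open>w\<close> is integrable.
  By Stone-Weierstrass and inner regularity \<open>\<mu> = - w dt\<close> on null sets, so \<open>\<mu> = 0\<close>.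
\<close>

subsection \<open>Phases of finite Blaschke products\<close>

text \<open>A nonempty open interval is not a null set, so a property holding almost everywhere has
  witnesses arbitrarily close to any point. Derivatives can therefore be tested along such
  witnesses.\<close>

lemma AE_lborel_imp_ex_in_right_interval:
  fixes t e :: real
  assumes "AE s in lborel. P s" "e > 0"
  shows "\<exists>s\<in>{t<..<t + e}. P s"
proof (rule ccontr)
  assume "\<not> ?thesis"
  then have "AE s in lborel. s \<notin> {t<..<t + e}"
    using assms(1) by (auto elim!: AE_mp)
  then have "emeasure lborel {t<..<t + e} = 0"
    by (subst (asm) AE_iff_measurable[of "{t<..<t + e}"]) auto
  then show False
    using \<open>e > 0\<close> by simp
qed

lemma cis_eq_near_imp_eq:
  assumes "cis x = cis y" "\<bar>x - y\<bar> < 2 * pi"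
  shows "x = y"
proof -
  have "cis (x - y) = 1"
    using assms(1) by (simp flip: cis_divide)
  then have "cos (x - y) = 1"
    by (simp add: complex_eq_iff)
  then obtain n :: int where n: "x - y = of_int n * 2 * pi"
    by (auto simp: cos_one_2pi_int)
  with assms(2) have "\<bar>real_of_int n\<bar> < 1"
    by (simp add: abs_mult)
  then have "n = 0"
    by linarith
  with n show ?thesis
    by simp
qed

text \<open>The phases themselves may differ by a different multiple of \<open>2*pi\<close> at each
  point, so only the derivatives can be compared. At a point where both are differentiable the
  difference is continuous, hence takes one and the same value at all nearby points where both
  phases represent the boundary value.\<close>

lemma is_phase_deriv_unique:
  assumes "is_phase g \<theta>1" "is_phase g \<theta>2"
  shows "AE t in lborel. t \<in> {0..2*pi} \<longrightarrow> deriv \<theta>1 t = deriv \<theta>2 t"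
proof -
  define E where "E t \<longleftrightarrow> (t \<in> {0..2*pi} \<longrightarrow> cis (\<theta>1 t) = cis (\<theta>2 t))" for t
  have E: "AE t in lborel. E t"
    using conjunct1[OF assms(1)[unfolded is_phase_def]] conjunct1[OF assms(2)[unfolded is_phase_def]]
    unfolding E_def by eventually_elim (blast intro: tendsto_unique[OF trivial_limit_at_left_real])
  have D: "AE t in lborel. t \<in> {0..2*pi} \<longrightarrow> \<theta>1 differentiable (at t) \<and> \<theta>2 differentiable (at t)"
    using assms unfolding is_phase_def by (auto elim!: AE_mp)
  \<comment> \<open>Away from the end points a whole neighbourhood of \<open>t\<close> lies in the
    interval on which \<open>E\<close> carries information.\<close>
  have ends: "AE t in lborel. t \<noteq> 0 \<and> t \<noteq> 2*pi"
    using AE_lborel_singleton[of "0::real"] AE_lborel_singleton[of "2*pi"] by eventually_elim auto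
  from E D ends show ?thesis
  proof eventually_elim
    case (elim t)
    show ?case
    proof
      assume t: "t \<in> {0..2*pi}"
      define d where "d s = \<theta>1 s - \<theta>2 s" for s
      define D where "D = deriv \<theta>1 t - deriv \<theta>2 t"
      have "(\<theta>1 has_real_derivative deriv \<theta>1 t) (at t)" "(\<theta>2 has_real_derivative deriv \<theta>2 t) (at t)"
        using elim t by (auto simp: DERIV_deriv_iff_real_differentiable)
      then have dD: "(d has_real_derivative D) (at t)"
        unfolding d_def D_def by (intro derivative_intros)
      have "D = 0"
      proof (rule ccontr)
        \<comment> \<open>A nonzero \<open>D\<close> forces \<open>d s \<noteq> d t\<close> near
          \<open>t\<close>, while continuity keeps the two less than \<open>2*pi\<close> apart. Then
          \<open>cis (d s)\<close> and \<open>cis (d t)\<close> differ, so \<open>E\<close> fails on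
          a punctured neighbourhood, which has positive measure.\<close>
        assume "D \<noteq> 0"
        have "((\<lambda>s. (d s - d t) / (s - t)) \<longlongrightarrow> D) (at t)"
          using dD by (simp add: has_field_derivative_iff)
        then have "\<forall>\<^sub>F s in at t. (d s - d t) / (s - t) \<noteq> 0"
          using \<open>D \<noteq> 0\<close> by (rule tendsto_imp_eventually_ne)
        moreover have "(d \<longlongrightarrow> d t) (at t)"
          using DERIV_isCont[OF dD] by (simp add: isCont_def)
        then have "\<forall>\<^sub>F s in at t. dist (d s) (d t) < 2 * pi"
          by (rule tendstoD) simp
        moreover have "\<forall>\<^sub>F s in at t. s \<in> {0<..<2*pi}"
          using elim t by (intro eventually_at_in_open') auto
        ultimately have "\<forall>\<^sub>F s in at t. \<not> E s"
        proof eventually_elim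
          case (elim s)
          show ?case
          proof
            assume "E s"
            with elim have "cis (\<theta>1 s) = cis (\<theta>2 s)" "cis (\<theta>1 t) = cis (\<theta>2 t)"
              using \<open>E t\<close> t by (auto simp: E_def)
            then have "cis (d s) = cis (d t)"
              by (simp add: d_def flip: cis_divide)
            with elim show False
              using cis_eq_near_imp_eq by (auto simp: dist_real_def)
          qed
        qed
        then obtain e where e: "e > 0" "\<And>s. s \<noteq> t \<Longrightarrow> dist s t < e \<Longrightarrow> \<not> E s"
          by (auto simp: eventually_at)
        from AE_lborel_imp_ex_in_right_interval[OF E e(1), of t] e(2) show False
          by (auto simp: dist_real_def)
      qed
      then show "deriv \<theta>1 t = deriv \<theta>2 t"
        by (simp add: D_def)
    qed
  qed
qed

lemma phase_freq_eqI:
  assumes "is_phase g \<theta>" "set_integrable lborel {0..2*pi} (deriv \<theta>)"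
  shows "phase_freq g = (LINT t:{0..2*pi}|lborel. deriv \<theta> t) / (2*pi)"
  unfolding phase_freq_def
proof (rule the_equality)
  fix m assume "\<exists>\<theta>. is_phase g \<theta> \<and> set_integrable lborel {0..2*pi} (deriv \<theta>) \<and>
       m = (LINT t:{0..2*pi}|lborel. deriv \<theta> t) / (2*pi)"
  then obtain \<theta>' where \<theta>': "is_phase g \<theta>'" "set_integrable lborel {0..2*pi} (deriv \<theta>')"
    "m = (LINT t:{0..2*pi}|lborel. deriv \<theta>' t) / (2*pi)"
    by blast
  have "(LINT t:{0..2*pi}|lborel. deriv \<theta>' t) = (LINT t:{0..2*pi}|lborel. deriv \<theta> t)"
    unfolding set_lebesgue_integral_def
  proof (rule integral_cong_AE)
    show "AE t in lborel. indicator {0..2*pi} t *\<^sub>R deriv \<theta>' t = indicator {0..2*pi} t *\<^sub>R deriv \<theta> t"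
      using is_phase_deriv_unique[OF \<theta>'(1) assms(1)] by eventually_elim (auto split: split_indicator)
  qed (use \<theta>'(2) assms(2) in \<open>auto simp: set_integrable_def\<close>)
  then show "m = (LINT t:{0..2*pi}|lborel. deriv \<theta> t) / (2*pi)"
    using \<theta>' by simp
qed (use assms in blast)

text \<open>With a continuously differentiable phase the mean-frequency is a winding number: the
  fundamental theorem of calculus turns the integral into the total increment of the phase.\<close>

lemma phase_freq_smooth_eqI:
  assumes lim: "\<And>t. ((\<lambda>r. g (of_real r * cis t)) \<longlongrightarrow> cis (\<theta> t)) (at_left 1)"
    and deriv: "\<And>t. (\<theta> has_real_derivative \<theta>' t) (at t)"
    and cont: "continuous_on UNIV \<theta>'"
  shows "phase_freq g = (\<theta> (2*pi) - \<theta> 0) / (2*pi)"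
proof -
  have d: "deriv \<theta> = \<theta>'"
    using deriv by (auto intro: DERIV_imp_deriv)
  have "is_phase g \<theta>"
    unfolding is_phase_def using lim deriv
    by (auto intro!: AE_I2 simp: real_differentiable_def)
  moreover have c: "continuous_on {0..2*pi} \<theta>'"
    using cont by (rule continuous_on_subset) simp
  moreover from c have "set_integrable lborel {0..2*pi} (deriv \<theta>)"
    unfolding d by (rule borel_integrable_atLeastAtMost')
  moreover have "(LINT t:{0..2*pi}|lborel. \<theta>' t) = \<theta> (2*pi) - \<theta> 0"
    unfolding set_lebesgue_integral_def
    by (rule integral_FTC_atLeastAtMost)
       (use c deriv in \<open>auto simp: has_real_derivative_iff_has_vector_derivative intro: has_vector_derivative_at_within\<close>)
  ultimately show ?thesis
    using phase_freq_eqI d by simp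
qed

section \<open>Finite Blaschke products and their boundary phases\<close>

definition finite_blaschke :: "complex multiset \<Rightarrow> complex \<Rightarrow> complex" where
  "finite_blaschke M z = (\<Prod>a\<in>#M. blaschke_factor a z)"

text \<open>The unimodular constant relating a normalized Blaschke factor to the plain Moebius
  factor; the value 1 at 0 matches the separate case in \<open>blaschke_factor\<close>.\<close>

definition blaschke_rotation :: "complex \<Rightarrow> complex" where
  "blaschke_rotation a = (if a = 0 then 1 else - of_real (cmod a) / a)"

lemma finite_blaschke_simps [simp]:
  "finite_blaschke {#} z = 1"
  "finite_blaschke (add_mset a M) z = blaschke_factor a z * finite_blaschke M z"
  by (simp_all add: finite_blaschke_def)

lemma norm_blaschke_rotation [simp]: "cmod (blaschke_rotation a) = 1"
  by (simp add: blaschke_rotation_def norm_divide)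

lemma blaschke_factor_eq: "blaschke_factor a z = blaschke_rotation a * ((z - a) / (1 - cnj a * z))"
  by (simp add: blaschke_factor_def blaschke_rotation_def divide_simps) (simp add: algebra_simps)

text \<open>Positivity of the real part keeps \<open>1 - cnj a * z\<close> off the branch cut, so
  the principal \<open>Ln\<close> of it is available on the whole closed disc.\<close>

lemma Re_one_minus_mult_pos:
  assumes "cmod a < 1" "cmod z \<le> 1"
  shows "Re (1 - cnj a * z) > 0"
proof -
  have "Re (cnj a * z) \<le> cmod (cnj a * z)"
    by (rule complex_Re_le_cmod)
  also have "\<dots> \<le> cmod a * 1"
    unfolding norm_mult complex_mod_cnj using assms by (intro mult_left_mono) auto
  finally show ?thesis
    using assms by simp
qed

lemma one_minus_mult_nonzero:
  assumes "cmod a < 1" "cmod z \<le> 1"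
  shows "1 - cnj a * z \<noteq> 0"
  using Re_one_minus_mult_pos[OF assms] by (metis less_irrefl zero_complex.sel(1))

lemma one_minus_mult_notin_nonpos_Reals:
  assumes "cmod a < 1" "cmod z \<le> 1"
  shows "1 - cnj a * z \<notin> \<real>\<^sub>\<le>\<^sub>0"
  using Re_one_minus_mult_pos[OF assms] by (auto simp: complex_nonpos_Reals_iff)

lemma blaschke_factor_eq_0_iff:
  assumes "a \<in> ball 0 1" "z \<in> ball 0 1"
  shows "blaschke_factor a z = 0 \<longleftrightarrow> z = a"
  using assms one_minus_mult_nonzero[of a z]
  by (auto simp: blaschke_factor_eq blaschke_rotation_def)

lemma continuous_on_blaschke_factor:
  assumes "a \<in> ball 0 1"
  shows "continuous_on (cball 0 1) (blaschke_factor a)"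
  unfolding blaschke_factor_eq using assms one_minus_mult_nonzero[of a]
  by (intro continuous_intros) auto

lemma finite_blaschke_eq_0_iff:
  assumes "set_mset M \<subseteq> ball 0 1" "z \<in> ball 0 1"
  shows "finite_blaschke M z = 0 \<longleftrightarrow> z \<in># M"
  using assms by (induction M) (auto simp: blaschke_factor_eq_0_iff)

lemma continuous_on_finite_blaschke:
  assumes "set_mset M \<subseteq> ball 0 1"
  shows "continuous_on (cball 0 1) (finite_blaschke M)"
  using assms
  by (induction M) (auto intro!: continuous_intros continuous_on_blaschke_factor)

text \<open>With \<open>w t = 1 - cnj a * cis t\<close>, the Moebius factor at \<open>cis t\<close>
  equals \<open>cis t * cnj (w t) / w t\<close>. As \<open>w\<close> stays in the right half-plane,
  its argument is smooth and periodic, so the increment \<open>2*pi\<close> comes from the summand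
  \<open>t\<close> alone.\<close>

lemma blaschke_factor_phase:
  assumes "a \<in> ball 0 1"
  obtains \<theta> \<theta>' where "\<And>t. blaschke_factor a (cis t) = cis (\<theta> t)"
    "\<And>t. (\<theta> has_real_derivative \<theta>' t) (at t)" "continuous_on UNIV \<theta>'"
    "\<theta> (2*pi) = \<theta> 0 + 2*pi"
proof -
  define w where "w t = 1 - cnj a * cis t" for t
  define w' where "w' t = - cnj a * (\<i> * cis t)" for t
  define \<theta> where "\<theta> t = Arg (blaschke_rotation a) + t - 2 * Im (Ln (w t))" for t
  define \<theta>' where "\<theta>' t = 1 - 2 * Im (w' t / w t)" for t
  have a: "cmod a < 1"
    using assms by simp
  have w0: "w t \<noteq> 0" "w t \<notin> \<real>\<^sub>\<le>\<^sub>0" for t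
    unfolding w_def
    using one_minus_mult_nonzero[OF a, of "cis t"] one_minus_mult_notin_nonpos_Reals[OF a, of "cis t"] by auto
  show thesis
  proof
    fix t
    \<comment> \<open>The numbers \<open>w t\<close> and \<open>cnj (w t)\<close> have equal modulus
      and opposite arguments.\<close>
    have "cis (- 2 * Im (Ln (w t))) = cnj (w t) / w t"
    proof -
      have "w t = cmod (w t) * cis (Arg (w t))"
        by (metis rcis_cmod_Arg rcis_def)
      moreover have "Im (Ln (w t)) = Arg (w t)"
        using w0(1) by (simp add: Arg_eq_Im_Ln)
      ultimately have "cnj (w t) = cmod (w t) * cis (- Im (Ln (w t)))" "w t = cmod (w t) * cis (Im (Ln (w t)))"
        by (metis complex_cnj_mult complex_cnj_complex_of_real cis_cnj, metis)
      then have "cnj (w t) / w t = (cmod (w t) * cis (- Im (Ln (w t)))) / (cmod (w t) * cis (Im (Ln (w t))))"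
        by metis
      also have "\<dots> = cis (- Im (Ln (w t)) - Im (Ln (w t)))"
        using w0[of t] by (simp only: cis_divide[symmetric]) simp
      finally show ?thesis
        by simp
    qed
    then have "cis (\<theta> t) = cis (Arg (blaschke_rotation a)) * cis t * (cnj (w t) / w t)"
      unfolding \<theta>_def by (metis cis_mult diff_conv_add_uminus mult_minus_left)
    also have "cis (Arg (blaschke_rotation a)) = blaschke_rotation a"
      by (metis norm_blaschke_rotation rcis_cmod_Arg rcis_def mult_1 of_real_1)
    also have "blaschke_rotation a * cis t * (cnj (w t) / w t) = blaschke_factor a (cis t)"
      unfolding blaschke_factor_eq w_def by (simp add: algebra_simps cis_mult cis_cnj)
    finally show "blaschke_factor a (cis t) = cis (\<theta> t)" ..
  next
    fix t
    have "(cis has_vector_derivative \<i> * cis t) (at t)"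
      unfolding has_vector_derivative_def by (rule has_derivative_cis[OF has_derivative_ident])
    then have "(w has_vector_derivative w' t) (at t)"
      unfolding w_def w'_def by (auto intro!: derivative_eq_intros)
    moreover have "(Ln has_field_derivative inverse (w t)) (at (w t))"
      using w0 by (intro has_field_derivative_Ln) auto
    ultimately have "((Ln \<circ> w) has_vector_derivative w' t * inverse (w t)) (at t)"
      by (rule field_vector_diff_chain_at)
    then have "((\<lambda>t. Im (Ln (w t))) has_real_derivative Im (w' t / w t)) (at t)"
      unfolding divide_inverse
      by (auto simp: has_vector_derivative_complex_iff o_def has_real_derivative_iff_has_vector_derivative)
    from DERIV_diff[OF DERIV_add[OF DERIV_const DERIV_ident] DERIV_cmult[OF this, of 2]]
    show "(\<theta> has_real_derivative \<theta>' t) (at t)"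
      unfolding \<theta>_def \<theta>'_def add_0 .
  next
    show "continuous_on UNIV \<theta>'"
      unfolding \<theta>'_def w'_def using w0 unfolding w_def by (intro continuous_intros) auto
    show "\<theta> (2*pi) = \<theta> 0 + 2*pi"
      unfolding \<theta>_def w_def by simp
  qed
qed

lemma finite_blaschke_phase:
  assumes "set_mset M \<subseteq> ball 0 1"
  obtains \<theta> \<theta>' where "\<And>t. finite_blaschke M (cis t) = cis (\<theta> t)"
    "\<And>t. (\<theta> has_real_derivative \<theta>' t) (at t)" "continuous_on UNIV \<theta>'"
    "\<theta> (2*pi) = \<theta> 0 + size M * (2*pi)"
  using assms
proof (induction M arbitrary: thesis)
  case empty
  show ?case
    by (rule empty.prems(1)[of "\<lambda>_. 0" "\<lambda>_. 0"]) auto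
next
  case (add a M)
  obtain \<theta> \<theta>' where 1: "\<And>t. finite_blaschke M (cis t) = cis (\<theta> t)"
    "\<And>t. (\<theta> has_real_derivative \<theta>' t) (at t)" "continuous_on UNIV \<theta>'"
    "\<theta> (2*pi) = \<theta> 0 + size M * (2*pi)"
    using add.IH add.prems(2) by auto
  obtain \<eta> \<eta>' where 2: "\<And>t. blaschke_factor a (cis t) = cis (\<eta> t)"
    "\<And>t. (\<eta> has_real_derivative \<eta>' t) (at t)" "continuous_on UNIV \<eta>'"
    "\<eta> (2*pi) = \<eta> 0 + 2*pi"
    using blaschke_factor_phase[of a] add.prems(2) by auto
  show ?case
    by (rule add.prems(1)[of "\<lambda>t. \<eta> t + \<theta> t" "\<lambda>t. \<eta>' t + \<theta>' t"])
       (use 1 2 in \<open>auto intro!: derivative_intros continuous_intros simp: cis_mult algebra_simps\<close>)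
qed

text \<open>The product is continuous up to the circle, so its boundary values are the radial
  limits, and \<open>c\<close> merely shifts the phase by \<open>Arg c\<close>. The case of the
  empty multiset gives frequency 0 for unimodular constants.\<close>

lemma phase_freq_finite_blaschke:
  assumes M: "set_mset M \<subseteq> ball 0 1" and c: "cmod c = 1"
    and g: "\<And>z. z \<in> ball 0 1 \<Longrightarrow> g z = c * finite_blaschke M z"
  shows "phase_freq g = size M"
proof -
  obtain \<theta> \<theta>' where \<theta>: "\<And>t. finite_blaschke M (cis t) = cis (\<theta> t)"
    "\<And>t. (\<theta> has_real_derivative \<theta>' t) (at t)" "continuous_on UNIV \<theta>'"
    "\<theta> (2*pi) = \<theta> 0 + size M * (2*pi)"
    using finite_blaschke_phase[OF M] by blast
  have "phase_freq g = ((Arg c + \<theta> (2*pi)) - (Arg c + \<theta> 0)) / (2*pi)"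
  proof (rule phase_freq_smooth_eqI)
    fix t
    have "continuous_on {0..1::real} (\<lambda>r. c * finite_blaschke M (of_real r * cis t))"
      by (intro continuous_intros continuous_on_compose2[OF continuous_on_finite_blaschke[OF M]])
         (auto simp: norm_mult)
    then have "((\<lambda>r. c * finite_blaschke M (of_real r * cis t)) \<longlongrightarrow> c * finite_blaschke M (of_real 1 * cis t)) (at 1 within {0..1})"
      unfolding continuous_on_def by (rule bspec) simp
    then have "((\<lambda>r. c * finite_blaschke M (of_real r * cis t)) \<longlongrightarrow> c * finite_blaschke M (cis t)) (at_left 1)"
      by (simp add: at_within_Icc_at_left)
    moreover have "c * finite_blaschke M (cis t) = cis (Arg c + \<theta> t)"
      using rcis_cmod_Arg[of c] c by (simp add: \<theta> rcis_def flip: cis_mult)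
    moreover have "\<forall>\<^sub>F r in at_left (1::real). g (of_real r * cis t) = c * finite_blaschke M (of_real r * cis t)"
      using eventually_at_left_real[OF zero_less_one]
      by eventually_elim (auto intro!: g simp: norm_mult)
    ultimately show "((\<lambda>r. g (of_real r * cis t)) \<longlongrightarrow> cis (Arg c + \<theta> t)) (at_left 1)"
      by (simp add: tendsto_cong)
  qed (use \<theta> in \<open>auto intro!: derivative_eq_intros\<close>)
  then show ?thesis
    using \<theta>(4) by simp
qed

subsection \<open>Herglotz integrals\<close>

text \<open>The density \<open>w\<close> lets one formula serve both the singular measure (with
  \<open>w = 1\<close>) and the logarithm of the boundary modulus (with
  \<open>M = lborel\<close>).\<close>

definition herglotz :: "real measure \<Rightarrow> (real \<Rightarrow> real) \<Rightarrow> complex \<Rightarrow> complex" where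
  "herglotz M w z = (LINT t|M. (cis t + z) / (cis t - z) * of_real (w t))"

text \<open>The exponent carries a plus sign, so the Taylor coefficients of Herglotz integrals
  involve the indices \<open>- int j\<close>.\<close>

definition fourier_coeff :: "real measure \<Rightarrow> (real \<Rightarrow> real) \<Rightarrow> int \<Rightarrow> complex" where
  "fourier_coeff M w j = (LINT t|M. cis (of_int j * t) * of_real (w t))"

lemma borel_measurable_cis [measurable]: "cis \<in> borel_measurable borel"
  by (intro borel_measurable_continuous_onI continuous_intros)

lemma integrable_bounded_mult_real:
  fixes w :: "real \<Rightarrow> real" and g :: "real \<Rightarrow> complex"
  assumes "sets M = sets borel" "integrable M w" "g \<in> borel_measurable borel" "\<And>t. cmod (g t) \<le> B"
  shows "integrable M (\<lambda>t. g t * of_real (w t))"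
proof (rule Bochner_Integration.integrable_bound)
  show "integrable M (\<lambda>t. B * norm (w t))"
    using assms(2) by simp
  have [measurable]: "g \<in> borel_measurable M" "w \<in> borel_measurable M"
    using assms(2,3) measurable_cong_sets[OF assms(1) refl] by auto
  show "(\<lambda>t. g t * of_real (w t)) \<in> borel_measurable M"
    by measurable
  have "0 \<le> B"
    using assms(4)[of 0] norm_ge_zero order_trans by blast
  then show "AE t in M. norm (g t * of_real (w t)) \<le> norm (B * norm (w t))"
    using assms(4) by (auto simp: norm_mult intro!: mult_right_mono)
qed

lemma cis_diff_nonzero: "z \<in> ball 0 1 \<Longrightarrow> cis t - z \<noteq> 0"
  by (metis diff_add_cancel eq_iff_diff_eq_0 mem_ball_0 norm_cis less_irrefl)

text \<open>With \<open>q = cis (- t) * z\<close> the kernel is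
  \<open>(1 + q) / (1 - q) = 2 / (1 - q) - 1\<close>, a geometric series; subtracting 1 is what
  makes the coefficient at \<open>j = 0\<close> equal to 1 instead of 2.\<close>

lemma herglotz_kernel_sums:
  assumes "z \<in> ball 0 1"
  shows "(\<lambda>j. (if j = 0 then 1 else 2) * cis (- real j * t) * z ^ j) sums ((cis t + z) / (cis t - z))"
proof -
  define q where "q = cis (- t) * z"
  have q: "cmod q < 1"
    using assms by (simp add: q_def norm_mult)
  have q1: "q \<noteq> 1"
    using q by auto
  have "(\<lambda>j. 2 * q ^ j) sums (2 * (1 / (1 - q)))"
    by (intro sums_mult geometric_sums q)
  moreover have "(\<lambda>j. if j = 0 then (1::complex) else 0) sums 1"
    by (rule sums_single)
  ultimately have "(\<lambda>j. 2 * q ^ j - (if j = 0 then 1 else 0)) sums (2 * (1 / (1 - q)) - 1)"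
    by (rule sums_diff)
  also have "2 * (1 / (1 - q)) - 1 = (cis t + z) / (cis t - z)"
  proof -
    have "z = cis t * q"
      by (simp add: q_def cis_mult flip: mult.assoc)
    then have "(cis t + z) / (cis t - z) = (cis t * (1 + q)) / (cis t * (1 - q))"
      by (simp add: distrib_left right_diff_distrib)
    also have "\<dots> = (1 + q) / (1 - q)"
      by (rule mult_divide_mult_cancel_left) simp
    finally show ?thesis
      using q1 by (simp add: divide_simps)
  qed
  also have "(\<lambda>j. 2 * q ^ j - (if j = 0 then 1 else 0)) = (\<lambda>j. (if j = 0 then 1 else 2) * cis (- real j * t) * z ^ j)"
    using Complex.DeMoivre[of "- t"] by (auto simp: q_def power_mult_distrib fun_eq_iff)
  finally show ?thesis .
qed

text \<open>Termwise integration of the kernel series, dominated by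
  \<open>2 * cmod z ^ j * \<bar>w t\<bar>\<close>. Fourier coefficients of the density thereby
  become Taylor coefficients of a holomorphic function.\<close>

lemma herglotz_sums:
  assumes M: "sets M = sets borel" and w: "integrable M w" and z: "z \<in> ball 0 1"
  shows "(\<lambda>j. (if j = 0 then 1 else 2) * fourier_coeff M w (- int j) * z ^ j) sums herglotz M w z"
proof -
  define f where "f j t = (if j = 0 then 1 else 2) * cis (- real j * t) * z ^ j * of_real (w t)" for j t
  define \<epsilon> where "\<epsilon> j = (if j = 0 then 1 else 2 :: real)" for j :: nat
  have fn: "norm (f j t) = \<epsilon> j * cmod z ^ j * \<bar>w t\<bar>" for j t
    by (simp add: f_def \<epsilon>_def norm_mult norm_power)
  have su: "summable (\<lambda>j. \<epsilon> j * cmod z ^ j)"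
  proof (rule summable_comparison_test')
    show "summable (\<lambda>j. 2 * cmod z ^ j)"
      using z by (intro summable_mult summable_geometric) auto
  qed (auto simp: \<epsilon>_def)
  have fi: "integrable M (\<lambda>t. cis (- real j * t) * of_real (w t))" for j
    by (rule integrable_bounded_mult_real[OF M w, where B = 1]) auto
  have f_eq: "f j = (\<lambda>t. ((if j = 0 then 1 else 2) * z ^ j) * (cis (- real j * t) * of_real (w t)))" for j
    by (auto simp: f_def)
  have "(\<lambda>j. integral\<^sup>L M (f j)) sums (\<integral>t. (\<Sum>j. f j t) \<partial>M)"
  proof (rule sums_integral)
    show "integrable M (f j)" for j
      unfolding f_eq by (intro integrable_mult_right fi)
    show "AE t in M. summable (\<lambda>j. norm (f j t))"
      unfolding fn by (intro AE_I2 summable_mult2 su)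
    show "summable (\<lambda>j. \<integral>t. norm (f j t) \<partial>M)"
      unfolding fn by (simp add: summable_mult2 su)
  qed
  also have "(\<lambda>t. \<Sum>j. f j t) = (\<lambda>t. (cis t + z) / (cis t - z) * of_real (w t))"
    unfolding f_def by (intro ext sums_unique[symmetric] sums_mult2 herglotz_kernel_sums z)
  also have "(\<lambda>j. integral\<^sup>L M (f j)) = (\<lambda>j. (if j = 0 then 1 else 2) * fourier_coeff M w (- int j) * z ^ j)"
    unfolding f_eq fourier_coeff_def integral_mult_right_zero by (auto simp: fun_eq_iff)
  finally show ?thesis
    by (simp add: herglotz_def)
qed

lemma holomorphic_on_herglotz:
  assumes "sets M = sets borel" "integrable M w"
  shows "herglotz M w holomorphic_on ball 0 1"
  by (rule power_series_holomorphic[where a = "\<lambda>j. (if j = 0 then 1 else 2) * fourier_coeff M w (- int j)"])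
     (use herglotz_sums[OF assms] in auto)

lemma integrable_herglotz_kernel:
  assumes M: "sets M = sets borel" and w: "integrable M w" and z: "z \<in> ball 0 1"
  shows "integrable M (\<lambda>t. (cis t + z) / (cis t - z) * of_real (w t))"
proof (rule integrable_bounded_mult_real[OF M w])
  show "(\<lambda>t. (cis t + z) / (cis t - z)) \<in> borel_measurable borel"
    by measurable
  fix t
  have "1 - cmod z \<le> cmod (cis t - z)"
    by (metis norm_cis norm_triangle_ineq2)
  moreover have "cmod (cis t + z) \<le> 2"
    using norm_triangle_ineq[of "cis t" z] z by simp
  ultimately show "cmod ((cis t + z) / (cis t - z)) \<le> 2 / (1 - cmod z)"
    unfolding norm_divide using z by (intro frac_le) auto
qed

lemma herglotz_add:
  assumes "sets M = sets borel" "integrable M v" "integrable M w" "z \<in> ball 0 1"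
  shows "herglotz M (\<lambda>t. v t + w t) z = herglotz M v z + herglotz M w z"
  unfolding herglotz_def of_real_add distrib_left
  by (intro Bochner_Integration.integral_add integrable_herglotz_kernel assms)

lemma herglotz_minus: "herglotz M (\<lambda>t. - w t) z = - herglotz M w z"
  by (simp add: herglotz_def)

lemma herglotz_cmult: "herglotz M (\<lambda>t. x * w t) z = of_real x * herglotz M w z"
  unfolding herglotz_def of_real_mult mult.left_commute[of _ "of_real x"] by (rule integral_mult_right_zero)

lemma fourier_coeff_uminus: "fourier_coeff M w (- j) = cnj (fourier_coeff M w j)"
  unfolding fourier_coeff_def Bochner_Integration.integral_cnj[symmetric]
  by (simp add: cis_cnj del: Bochner_Integration.integral_cnj)

lemma fourier_coeff_0_real: "fourier_coeff M w 0 = of_real (LINT t|M. w t)"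
  by (simp add: fourier_coeff_def)

text \<open>A holomorphic function with constant exponential on the disc is constant, so its Taylor
  coefficients of positive degree vanish. The one of degree 0 is real with an exponential of modulus
  1, hence also 0. Conjugation gives the Fourier coefficients of opposite sign, as the densities are
  real.\<close>

lemma fourier_coeff_eq_0_of_exp_const:
  assumes M: "sets M = sets borel" "integrable M v" and N: "sets N = sets borel" "integrable N w"
    and c: "cmod c = 1"
    and exp: "\<And>z. z \<in> ball 0 1 \<Longrightarrow> exp (herglotz M v z + herglotz N w z) = c"
  shows "fourier_coeff M v j + fourier_coeff N w j = 0"
proof -
  define A where "A z = herglotz M v z + herglotz N w z" for z
  define e where "e j = (if j = 0 then 1 else 2 :: complex) * (fourier_coeff M v (- int j) + fourier_coeff N w (- int j))" for j :: nat
  have A: "(\<lambda>j. e j * z ^ j) sums A z" if "z \<in> ball 0 1" for z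
    using sums_add[OF herglotz_sums[OF M that] herglotz_sums[OF N that]]
    unfolding A_def e_def by (simp add: algebra_simps)
  have "A holomorphic_on ball 0 1"
    unfolding A_def using M N by (intro holomorphic_intros holomorphic_on_herglotz)
  have "(A has_field_derivative 0) (at z within ball 0 1)" if z: "z \<in> ball 0 1" for z
  proof -
    have A': "(A has_field_derivative deriv A z) (at z)"
      using \<open>A holomorphic_on ball 0 1\<close> z by (meson holomorphic_derivI open_ball)
    then have "((\<lambda>z. exp (A z)) has_field_derivative exp (A z) * deriv A z) (at z)"
      by (rule DERIV_fun_exp)
    moreover have "((\<lambda>z. exp (A z)) has_field_derivative 0) (at z)"
      by (rule has_field_derivative_transform_within_open[where f = "\<lambda>_. c" and S = "ball 0 1"])
         (use z exp in \<open>auto simp: A_def\<close>)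
    ultimately have "deriv A z = 0"
      using DERIV_unique by fastforce
    with A' show ?thesis
      by (metis has_field_derivative_at_within)
  qed
  then obtain k where k: "A z = k" if "z \<in> ball 0 1" for z
    using has_field_derivative_zero_constant[of "ball 0 1" A] by auto
  have eval: "eval_fps (Abs_fps e) z = k" if "z \<in> ball 0 1" for z
    using A[OF that] k[OF that] by (simp add: eval_fps_def sums_iff)
  \<comment> \<open>Convergence at the single point \<open>1/2\<close> already gives the positive
    radius required for comparing power series coefficients.\<close>
  have "summable (\<lambda>j. fps_nth (Abs_fps e) j * (1/2) ^ j)"
    using A[of "1/2"] by (auto simp: sums_iff)
  then have "fps_conv_radius (Abs_fps e) \<ge> norm (1/2 :: complex)"
    unfolding fps_conv_radius_def by (rule conv_radius_geI)
  then have r: "fps_conv_radius (Abs_fps e) > 0"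
    by (rule less_le_trans[rotated]) simp
  have "Abs_fps e = fps_const k"
  proof (rule eval_fps_eqD[OF r])
    have "\<forall>\<^sub>F z in nhds 0. z \<in> ball (0::complex) 1"
      by (intro eventually_nhds_in_open) auto
    then show "\<forall>\<^sub>F z in nhds 0. eval_fps (Abs_fps e) z = eval_fps (fps_const k) z"
      by eventually_elim (use eval in auto)
  qed simp
  then have e: "e j = (if j = 0 then k else 0)" for j
    using fps_nth_Abs_fps[of e j] by (simp del: fps_nth_Abs_fps)
  have "e 0 = of_real ((LINT t|M. v t) + (LINT t|N. w t))"
    by (simp add: e_def fourier_coeff_0_real)
  moreover have "cmod (exp (e 0)) = 1"
    using exp[of 0] c k[of 0] e[of 0] by (simp add: A_def)
  ultimately have "e 0 = 0"
    by (simp del: of_real_add)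
  then have e0: "e j = 0" for j
    using e[of 0] e[of j] by simp
  have neg: "fourier_coeff M v (- int j) + fourier_coeff N w (- int j) = 0" for j
    using e0[of j] by (auto simp: e_def split: if_splits)
  show ?thesis
  proof (cases "j \<le> 0")
    case True
    then show ?thesis
      using neg[of "nat (- j)"] by simp
  next
    case False
    then show ?thesis
      using arg_cong[OF neg[of "nat j"], of cnj] by (simp add: fourier_coeff_uminus)
  qed
qed

subsection \<open>Outer functions\<close>

text \<open>Here and in the elimination rule below, the factor \<open>1 / (2*pi)\<close> is absorbed
  into the density and the set integral is replaced by a density vanishing off the interval. Both
  kinds of factor are then expressed by \<open>herglotz\<close>.\<close>

lemma outer_funI:
  assumes c: "cmod c = 1" and w: "integrable lborel w" "\<And>t. t \<notin> {0..2*pi} \<Longrightarrow> w t = 0"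
    and g: "\<And>z. z \<in> ball 0 1 \<Longrightarrow> g z = c * exp (herglotz lborel w z)"
  shows "outer_fun g"
  unfolding outer_fun_def
proof (intro exI conjI ballI)
  show "cmod c = 1" by fact
  have "indicator {0..2*pi} t *\<^sub>R (2*pi * w t) = 2*pi * w t" for t
    using w(2)[of t] by (auto split: split_indicator)
  then show "set_integrable lborel {0..2*pi} (\<lambda>t. 2*pi * w t)"
    unfolding set_integrable_def using w(1) by (simp only: integrable_mult_right)
  fix z :: complex assume z: "z \<in> ball 0 1"
  have "(LINT t:{0..2*pi}|lborel. (cis t + z) / (cis t - z) * of_real (2*pi * w t)) =
      herglotz lborel (\<lambda>t. 2*pi * w t) z"
    unfolding set_lebesgue_integral_def herglotz_def
    by (intro Bochner_Integration.integral_cong) (use w(2) in \<open>auto split: split_indicator\<close>)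
  then show "g z = c * exp ((1 / (2*pi)) * (LINT t:{0..2*pi}|lborel. (cis t + z) / (cis t - z) * of_real (2*pi * w t)))"
    using g[OF z] by (simp add: herglotz_cmult)
qed

lemma outer_funE:
  assumes "outer_fun g"
  obtains c w where "cmod c = 1" "integrable lborel w" "\<And>t. t \<notin> {0..2*pi} \<Longrightarrow> w t = 0"
    "\<And>z. z \<in> ball 0 1 \<Longrightarrow> g z = c * exp (herglotz lborel w z)"
proof -
  obtain c h where c: "cmod c = 1" and h: "set_integrable lborel {0..2*pi} h" and
    g: "\<And>z. z\<in>ball 0 1 \<Longrightarrow> g z = c * exp ((1 / (2*pi)) *
         (LINT t:{0..2*pi}|lborel. (cis t + z) / (cis t - z) * of_real (h t)))"
    using assms unfolding outer_fun_def by blast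
  define w where "w t = 1 / (2*pi) * (indicator {0..2*pi} t *\<^sub>R h t)" for t
  show thesis
  proof
    show "integrable lborel w"
      using h unfolding w_def set_integrable_def by (intro integrable_mult_right)
    show "w t = 0" if "t \<notin> {0..2*pi}" for t
      using that by (simp add: w_def)
    fix z :: complex assume z: "z \<in> ball 0 1"
    have "(LINT t:{0..2*pi}|lborel. (cis t + z) / (cis t - z) * of_real (h t)) =
        herglotz lborel (\<lambda>t. indicator {0..2*pi} t *\<^sub>R h t) z"
      unfolding set_lebesgue_integral_def herglotz_def
      by (intro Bochner_Integration.integral_cong) (auto split: split_indicator)
    then show "g z = c * exp (herglotz lborel w z)"
      using g[OF z] unfolding w_def herglotz_cmult by simp
  qed fact
qed

lemma outer_fun_holomorphic: "outer_fun g \<Longrightarrow> g holomorphic_on ball 0 1"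
proof (elim outer_funE)
  fix c w assume "integrable lborel w" "\<And>z. z \<in> ball 0 1 \<Longrightarrow> g z = c * exp (herglotz lborel w z)"
  then show ?thesis
    by (subst holomorphic_cong[OF refl, where g = "\<lambda>z. c * exp (herglotz lborel w z)"])
       (auto intro!: holomorphic_intros holomorphic_on_herglotz)
qed

lemma outer_fun_nonzero: "outer_fun g \<Longrightarrow> z \<in> ball 0 1 \<Longrightarrow> g z \<noteq> 0"
  by (elim outer_funE) auto

text \<open>Herglotz integrals are additive in the density, so a quotient of two exponentials
  belongs to the difference of the densities; the constants combine into one of modulus 1.\<close>

lemma outer_fun_divide:
  assumes "outer_fun u" "outer_fun v" "cmod k = 1"
    and g: "\<And>z. z \<in> ball 0 1 \<Longrightarrow> g z = k * u z / v z"
  shows "outer_fun g"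
proof -
  obtain c w where u: "cmod c = 1" "integrable lborel w" "\<And>t. t \<notin> {0..2*pi} \<Longrightarrow> w t = 0"
    "\<And>z. z \<in> ball 0 1 \<Longrightarrow> u z = c * exp (herglotz lborel w z)"
    using outer_funE[OF assms(1)] by blast
  obtain d y where v: "cmod d = 1" "integrable lborel y" "\<And>t. t \<notin> {0..2*pi} \<Longrightarrow> y t = 0"
    "\<And>z. z \<in> ball 0 1 \<Longrightarrow> v z = d * exp (herglotz lborel y z)"
    using outer_funE[OF assms(2)] by blast
  show ?thesis
  proof (rule outer_funI[where w = "\<lambda>t. w t + - y t"])
    show "cmod (k * c / d) = 1"
      using u v assms by (simp add: norm_mult norm_divide)
    fix z :: complex assume z: "z \<in> ball 0 1"
    have "herglotz lborel (\<lambda>t. w t + - y t) z = herglotz lborel w z - herglotz lborel y z"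
      by (subst herglotz_add) (use u v z in \<open>auto simp: herglotz_minus\<close>)
    then show "g z = k * c / d * exp (herglotz lborel (\<lambda>t. w t + - y t) z)"
      using g[OF z] u(4)[OF z] v(4)[OF z] by (simp add: exp_diff)
  qed (use u v in auto)
qed

section \<open>The Schwarz integral formula and zero-free functions as outer functions\<close>

lemma circle_cauchy_formula:
  assumes L: "L holomorphic_on cball 0 1" and z: "z \<in> ball 0 1"
  shows "((\<lambda>t. cis t * L (cis t) / (cis t - z)) has_integral 2 * of_real pi * L z) {0..2*pi}"
proof -
  have "((\<lambda>u. L u / (u - z)) has_contour_integral 2 * of_real pi * \<i> * L z) (part_circlepath 0 1 0 (2*pi))"
    using Cauchy_integral_circlepath_simple[OF L, of z] z by (simp add: circlepath_def)
  then have "((\<lambda>t. L (cis t) / (cis t - z) * \<i> * cis t) has_integral 2 * of_real pi * \<i> * L z) {0..2*pi}"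
    by (simp add: has_contour_integral_part_circlepath_iff)
  from has_integral_mult_left[OF this, of "- \<i>"] show ?thesis
    by (simp add: mult_ac)
qed

text \<open>Write \<open>2 * Re L = L + cnj L\<close>. Against \<open>L\<close> the kernel is
  \<open>2 * cis t / (cis t - z) - 1\<close>, and Cauchy's formula yields
  \<open>2 * L z - L 0\<close>. Against \<open>cnj L\<close> the mean value property yields
  \<open>cnj (L 0)\<close>. Half the sum is \<open>L z - \<i> * Im (L 0)\<close>.\<close>

lemma has_integral_schwarz_formula:
  assumes L: "L holomorphic_on cball 0 1" and z: "z \<in> ball 0 1"
  shows "((\<lambda>t. (cis t + z) / (cis t - z) * of_real (Re (L (cis t)))) has_integral
      2 * of_real pi * (L z - \<i> * of_real (Im (L 0)))) {0..2*pi}"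
proof -
  define K where "K t = (cis t + z) / (cis t - z)" for t
  have nz: "cis t - z \<noteq> 0" for t
    using z by (rule cis_diff_nonzero)
  have mean: "((\<lambda>t. G (cis t)) has_integral 2 * of_real pi * G 0) {0..2*pi}" if "G holomorphic_on cball 0 1" for G
    using circle_cauchy_formula[OF that, of 0] by simp
  have "((\<lambda>t. 2 * (cis t * L (cis t) / (cis t - z)) - L (cis t)) has_integral
      2 * (2 * of_real pi * L z) - 2 * of_real pi * L 0) {0..2*pi}"
    by (intro has_integral_diff has_integral_mult_right circle_cauchy_formula[OF L z] mean[OF L])
  also have "(\<lambda>t. 2 * (cis t * L (cis t) / (cis t - z)) - L (cis t)) = (\<lambda>t. K t * L (cis t))"
    unfolding K_def using nz by (intro ext) (simp add: divide_simps, simp add: algebra_simps)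
  finally have 1: "((\<lambda>t. K t * L (cis t)) has_integral 2 * (2 * of_real pi * L z) - 2 * of_real pi * L 0) {0..2*pi}" .
  \<comment> \<open>On the circle conjugation is inversion, so the kernel times \<open>cnj L\<close>
    is the conjugate of the boundary values of the holomorphic function \<open>G\<close>, and
    \<open>G 0 = L 0\<close>.\<close>
  define G where "G \<zeta> = (1 + cnj z * \<zeta>) / (1 - cnj z * \<zeta>) * L \<zeta>" for \<zeta>
  have "G holomorphic_on cball 0 1"
    unfolding G_def using one_minus_mult_nonzero[of z] z by (intro holomorphic_intros L) auto
  from mean[OF this] have "((\<lambda>t. cnj (G (cis t))) has_integral cnj (2 * of_real pi * G 0)) {0..2*pi}"
    by (subst (asm) has_integral_cnj[symmetric]) (simp only: o_def)
  also have "(\<lambda>t. cnj (G (cis t))) = (\<lambda>t. K t * cnj (L (cis t)))"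
  proof
    fix t
    have "cnj (G (cis t)) = (1 + z * cis (- t)) / (1 - z * cis (- t)) * cnj (L (cis t))"
      by (simp add: G_def cis_cnj)
    also have "(1 + z * cis (- t)) / (1 - z * cis (- t)) =
        (cis t * (1 + z * cis (- t))) / (cis t * (1 - z * cis (- t)))"
      by (rule mult_divide_mult_cancel_left[symmetric]) simp
    also have "\<dots> = K t"
      by (simp add: K_def distrib_left right_diff_distrib mult.left_commute[of "cis t"] cis_mult)
    finally show "cnj (G (cis t)) = K t * cnj (L (cis t))" .
  qed
  also have "cnj (2 * of_real pi * G 0) = 2 * of_real pi * cnj (L 0)"
    by (simp add: G_def)
  finally have 2: "((\<lambda>t. K t * cnj (L (cis t))) has_integral 2 * of_real pi * cnj (L 0)) {0..2*pi}" .
  have "((\<lambda>t. (K t * L (cis t) + K t * cnj (L (cis t))) * (1/2)) has_integral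
      ((2 * (2 * of_real pi * L z) - 2 * of_real pi * L 0) + 2 * of_real pi * cnj (L 0)) * (1/2)) {0..2*pi}"
    by (intro has_integral_mult_left has_integral_add 1 2)
  also have "(\<lambda>t. (K t * L (cis t) + K t * cnj (L (cis t))) * (1/2)) = (\<lambda>t. K t * of_real (Re (L (cis t))))"
    by (simp flip: distrib_left add: complex_add_cnj)
  also have "((2 * (2 * of_real pi * L z) - 2 * of_real pi * L 0) + 2 * of_real pi * cnj (L 0)) * (1/2) =
      2 * of_real pi * (L z - \<i> * of_real (Im (L 0)))"
    by (simp add: complex_eq_iff algebra_simps)
  finally show ?thesis
    unfolding K_def .
qed

text \<open>The logarithm of the boundary modulus is \<open>Re L\<close>, from which the Schwarz
  formula recovers \<open>L\<close> up to the imaginary constant \<open>Im (L 0)\<close>; that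
  constant becomes the unimodular factor.\<close>

lemma outer_fun_exp:
  assumes L: "L holomorphic_on cball 0 1"
    and g: "\<And>z. z \<in> ball 0 1 \<Longrightarrow> g z = exp (L z)"
  shows "outer_fun g"
proof (rule outer_funI)
  define w where "w t = indicator {0..2*pi} t *\<^sub>R (Re (L (cis t)) / (2*pi))" for t
  have Lc: "continuous_on {0..2*pi} (\<lambda>t. L (cis t))"
    by (rule continuous_on_compose2[OF holomorphic_on_imp_continuous_on[OF L]]) (auto intro!: continuous_intros)
  show "cmod (cis (Im (L 0))) = 1"
    by simp
  have "set_integrable lborel {0..2*pi} (\<lambda>t. Re (L (cis t)) / (2*pi))"
    by (intro borel_integrable_atLeastAtMost' continuous_intros Lc) auto
  then show w: "integrable lborel w"
    unfolding w_def set_integrable_def .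
  show "w t = 0" if "t \<notin> {0..2*pi}" for t
    using that by (simp add: w_def)
  fix z :: complex assume z: "z \<in> ball 0 1"
  define F where "F t = (cis t + z) / (cis t - z) * of_real (Re (L (cis t)))" for t
  have "set_integrable lborel {0..2*pi} F"
    unfolding F_def using cis_diff_nonzero[OF z]
    by (intro borel_integrable_atLeastAtMost' continuous_intros Lc) auto
  then have "(LINT t:{0..2*pi}|lborel. F t) = integral {0..2*pi} F"
    by (rule set_borel_integral_eq_integral)
  also have "\<dots> = 2 * of_real pi * (L z - \<i> * of_real (Im (L 0)))"
    unfolding F_def by (rule integral_unique[OF has_integral_schwarz_formula[OF L z]])
  finally have F: "(LINT t:{0..2*pi}|lborel. F t) = 2 * of_real pi * (L z - \<i> * of_real (Im (L 0)))" .
  have "herglotz lborel w z = (LINT t|lborel. 1 / (2 * of_real pi) * (indicator {0..2*pi} t *\<^sub>R F t))"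
    unfolding herglotz_def w_def F_def
    by (intro Bochner_Integration.integral_cong) (auto split: split_indicator)
  also have "\<dots> = 1 / (2 * of_real pi) * (LINT t:{0..2*pi}|lborel. F t)"
    unfolding set_lebesgue_integral_def by (rule integral_mult_right_zero)
  also have "\<dots> = L z - \<i> * of_real (Im (L 0))"
    unfolding F by simp
  finally show "g z = cis (Im (L 0)) * exp (herglotz lborel w z)"
    using g[OF z] by (simp add: exp_diff cis_conv_exp)
qed

lemma outer_fun_szego:
  assumes C: "C \<noteq> 0" and a: "cmod a < 1"
  shows "outer_fun (\<lambda>z. C / (1 - cnj a * z) ^ k)"
proof (rule outer_fun_exp)
  show "(\<lambda>z. Ln C - of_nat k * Ln (1 - cnj a * z)) holomorphic_on cball 0 1"
    using one_minus_mult_notin_nonpos_Reals[OF a] by (intro holomorphic_intros) auto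
  fix z :: complex assume "z \<in> ball 0 1"
  then have "1 - cnj a * z \<noteq> 0"
    using one_minus_mult_nonzero[OF a, of z] by auto
  then show "C / (1 - cnj a * z) ^ k = exp (Ln C - of_nat k * Ln (1 - cnj a * z))"
    using C by (simp add: exp_diff exp_of_nat_mult)
qed

subsection \<open>Measures with vanishing Fourier coefficients\<close>

text \<open>The span of the exponentials, generated inductively so that closure under products
  follows by a double induction.\<close>

inductive trig_poly :: "(real \<Rightarrow> complex) \<Rightarrow> bool" where
  monom: "trig_poly (\<lambda>t. c * cis (of_int j * t))"
| add: "trig_poly f \<Longrightarrow> trig_poly g \<Longrightarrow> trig_poly (\<lambda>t. f t + g t)"

lemma trig_poly_mult:
  assumes "trig_poly f" "trig_poly g"
  shows "trig_poly (\<lambda>t. f t * g t)"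
  using assms
proof (induction arbitrary: g rule: trig_poly.induct)
  case (monom c j)
  from monom.prems show ?case
  proof (induction rule: trig_poly.induct)
    case (monom d k)
    have "c * cis (of_int j * t) * (d * cis (of_int k * t)) = c * d * cis (of_int (j + k) * t)" for t
      by (simp add: distrib_right flip: cis_mult)
    then show ?case
      using trig_poly.monom[of "c * d" "j + k"] by (simp only:)
  next
    case (add f g)
    then show ?case
      by (simp add: distrib_left trig_poly.add)
  qed
next
  case (add f1 f2)
  then show ?case
    by (simp add: distrib_right trig_poly.add)
qed

lemma trig_poly_const: "trig_poly (\<lambda>t. c)"
  using trig_poly.monom[of c 0] by simp

text \<open>Links the polynomials in the real coordinates of the plane, which Stone-Weierstrass
  supplies, to trigonometric polynomials on the circle.\<close>

lemma trig_poly_real_polynomial_function: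
  assumes "real_polynomial_function p"
  shows "trig_poly (\<lambda>t. of_real (p (cis t)))"
  using assms
proof (induction rule: real_polynomial_function.induct)
  case (linear f)
  then interpret bounded_linear f .
  \<comment> \<open>By real linearity \<open>f (cis t) = cos t * f 1 + sin t * f \<i>\<close>;
    Euler's formulas for cosine and sine produce these two coefficients.\<close>
  have "complex_of_real (f (cis t)) =
      (f 1 - \<i> * f \<i>) / 2 * cis (of_int 1 * t) + (f 1 + \<i> * f \<i>) / 2 * cis (of_int (- 1) * t)" for t
  proof -
    have "cis t = cos t *\<^sub>R 1 + sin t *\<^sub>R \<i>"
      by (simp add: complex_eq_iff)
    then have "f (cis t) = cos t * f 1 + sin t * f \<i>"
      using add[of "cos t *\<^sub>R 1" "sin t *\<^sub>R \<i>"] scaleR[of "cos t" 1] scaleR[of "sin t" \<i>] by simp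
    then show ?thesis
      by (simp add: complex_eq_iff field_simps)
  qed
  then show ?case
    using trig_poly.add[OF trig_poly.monom[of "(f 1 - \<i> * f \<i>) / 2" 1] trig_poly.monom[of "(f 1 + \<i> * f \<i>) / 2" "- 1"]]
    by simp
qed (auto simp: trig_poly_const trig_poly_mult trig_poly.add)

section \<open>Annihilation of functions on the circle by a pair of densities\<close>

context
  fixes M N :: "real measure" and v w :: "real \<Rightarrow> real"
  assumes M: "sets M = sets borel" "integrable M v"
    and N: "sets N = sets borel" "integrable N w"
    and fourier: "\<And>j. fourier_coeff M v j + fourier_coeff N w j = 0"
begin

lemma borel_measurable_M_N:
  "f \<in> borel_measurable borel \<Longrightarrow> f \<in> borel_measurable M"
  "f \<in> borel_measurable borel \<Longrightarrow> f \<in> borel_measurable N"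
  using measurable_cong_sets[OF M(1) refl] measurable_cong_sets[OF N(1) refl] by auto

lemma trig_poly_pairing_eq_0:
  assumes "trig_poly g"
  shows "integrable M (\<lambda>t. g t * of_real (v t))" "integrable N (\<lambda>t. g t * of_real (w t))"
    "(LINT t|M. g t * of_real (v t)) + (LINT t|N. g t * of_real (w t)) = 0"
  using assms
proof (induction rule: trig_poly.induct)
  case (monom c j)
  have "integrable M (\<lambda>t. cis (of_int j * t) * of_real (v t))" "integrable N (\<lambda>t. cis (of_int j * t) * of_real (w t))"
    by (rule integrable_bounded_mult_real[OF M, where B = 1] integrable_bounded_mult_real[OF N, where B = 1]; simp)+
  then show "integrable M (\<lambda>t. c * cis (of_int j * t) * of_real (v t))"
    "integrable N (\<lambda>t. c * cis (of_int j * t) * of_real (w t))"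
    unfolding mult.assoc by (auto intro!: integrable_mult_right)
  show "(LINT t|M. c * cis (of_int j * t) * of_real (v t)) + (LINT t|N. c * cis (of_int j * t) * of_real (w t)) = 0"
    using fourier[of j] unfolding mult.assoc integral_mult_right_zero fourier_coeff_def
    by (metis distrib_left mult_zero_right)
next
  case (add f g)
  then show "integrable M (\<lambda>t. (f t + g t) * of_real (v t))" "integrable N (\<lambda>t. (f t + g t) * of_real (w t))"
    by (simp_all add: distrib_right)
  have "(LINT t|M. (f t + g t) * of_real (v t)) + (LINT t|N. (f t + g t) * of_real (w t)) =
    ((LINT t|M. f t * of_real (v t)) + (LINT t|N. f t * of_real (w t))) +
    ((LINT t|M. g t * of_real (v t)) + (LINT t|N. g t * of_real (w t)))"
    using add by (simp add: distrib_right add_ac)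
  then show "(LINT t|M. (f t + g t) * of_real (v t)) + (LINT t|N. (f t + g t) * of_real (w t)) = 0"
    using add by simp
qed

text \<open>Approximate \<open>F\<close> on the circle within \<open>e\<close> by a polynomial,
  whose pairing is 0. The error is at most \<open>e\<close> times the total mass \<open>B\<close> of
  the two densities.\<close>

lemma continuous_pairing_eq_0:
  fixes F :: "complex \<Rightarrow> real"
  assumes F: "continuous_on UNIV F"
  shows "(LINT t|M. F (cis t) * v t) + (LINT t|N. F (cis t) * w t) = 0" (is "?\<Lambda> = 0")
proof -
  define B where "B = (LINT t|M. \<bar>v t\<bar>) + (LINT t|N. \<bar>w t\<bar>)"
  have B: "B \<ge> 0"
    unfolding B_def by (intro add_nonneg_nonneg integral_nonneg) auto
  have small: "\<bar>?\<Lambda>\<bar> \<le> e * B" if "e > 0" for e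
  proof -
    obtain p where p: "real_polynomial_function p" and Fp: "\<And>x. x \<in> sphere 0 1 \<Longrightarrow> \<bar>F x - p x\<bar> < e"
      using Stone_Weierstrass_real_polynomial_function[OF compact_sphere continuous_on_subset[OF F subset_UNIV] \<open>e > 0\<close>]
      by metis
    have pc: "continuous_on UNIV p"
      using p continuous_on_polymonial_function real_polynomial_function_eq by blast
    have p0: "integrable M (\<lambda>t. p (cis t) * v t)" "integrable N (\<lambda>t. p (cis t) * w t)"
      "(LINT t|M. p (cis t) * v t) + (LINT t|N. p (cis t) * w t) = 0"
      using trig_poly_pairing_eq_0[OF trig_poly_real_polynomial_function[OF p]]
      by (simp_all add: complex_of_real_integrable_eq flip: of_real_mult of_real_add)
    have Fpm: "(\<lambda>t. F (cis t) - p (cis t)) \<in> borel_measurable borel"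
      by (intro borel_measurable_continuous_onI continuous_intros continuous_on_compose2[OF F] continuous_on_compose2[OF pc]) auto
    have bd: "\<bar>F (cis t) - p (cis t)\<bar> \<le> e" for t
      using Fp[of "cis t"] by simp
    have bdm: "norm ((F (cis t) - p (cis t)) * x) \<le> e * \<bar>x\<bar>" for t x
      using bd[of t] by (auto simp: abs_mult intro!: mult_right_mono)
    have iM: "integrable M (\<lambda>t. (F (cis t) - p (cis t)) * v t)"
      by (rule Bochner_Integration.integrable_bound[where f = "\<lambda>t. e * \<bar>v t\<bar>"])
         (use borel_measurable_M_N(1)[OF Fpm] M(2) bdm \<open>e > 0\<close> in \<open>auto simp: abs_mult\<close>)
    have iN: "integrable N (\<lambda>t. (F (cis t) - p (cis t)) * w t)"
      by (rule Bochner_Integration.integrable_bound[where f = "\<lambda>t. e * \<bar>w t\<bar>"])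
         (use borel_measurable_M_N(2)[OF Fpm] N(2) bdm \<open>e > 0\<close> in \<open>auto simp: abs_mult\<close>)
    have "\<bar>LINT t|M. (F (cis t) - p (cis t)) * v t\<bar> \<le> (LINT t|M. e * \<bar>v t\<bar>)"
      using bdm by (intro order_trans[OF integral_abs_bound] integral_mono) (use iM M(2) in auto)
    moreover have "\<bar>LINT t|N. (F (cis t) - p (cis t)) * w t\<bar> \<le> (LINT t|N. e * \<bar>w t\<bar>)"
      using bdm by (intro order_trans[OF integral_abs_bound] integral_mono) (use iN N(2) in auto)
    moreover have "(LINT t|M. F (cis t) * v t) = (LINT t|M. (F (cis t) - p (cis t)) * v t) + (LINT t|M. p (cis t) * v t)"
      using iM p0(1) by (subst Bochner_Integration.integral_add[symmetric]) (auto simp: algebra_simps)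
    moreover have "(LINT t|N. F (cis t) * w t) = (LINT t|N. (F (cis t) - p (cis t)) * w t) + (LINT t|N. p (cis t) * w t)"
      using iN p0(2) by (subst Bochner_Integration.integral_add[symmetric]) (auto simp: algebra_simps)
    ultimately show ?thesis
      using p0(3) by (simp add: B_def distrib_left)
  qed
  show ?thesis
  proof (rule ccontr)
    assume "?\<Lambda> \<noteq> 0"
    \<comment> \<open>Dividing by \<open>B + 1\<close> covers \<open>B = 0\<close> and makes the
      resulting estimate strictly contradictory.\<close>
    then have "\<bar>?\<Lambda>\<bar> / (B + 1) > 0"
      using B by simp
    from small[OF this] have "\<bar>?\<Lambda>\<bar> * (B + 1) \<le> \<bar>?\<Lambda>\<bar> * B"
      using B by (simp add: field_simps)
    with \<open>?\<Lambda> \<noteq> 0\<close> show False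
      by (simp add: distrib_left)
  qed
qed

text \<open>The pairing sees only functions of \<open>cis t\<close>, so \<open>K\<close> is enlarged
  to all points with the same image on the circle. Its indicator is a bounded pointwise limit of
  continuous functions, and dominated convergence applies.\<close>

lemma compact_pairing_eq_0:
  assumes K: "compact K"
  shows "(LINT t|M. indicator (cis -` cis ` K) t * v t) + (LINT t|N. indicator (cis -` cis ` K) t * w t) = 0"
\<comment> \<open>The empty set is split off because \<open>infdist\<close> to it is 0 by
  convention, which would make every \<open>F n\<close> below equal to 1.\<close>
proof (cases "K = {}")
  case False
  define C where "C = cis ` K"
  have C: "closed C" "C \<noteq> {}"
    unfolding C_def using K False
    by (auto intro!: compact_imp_closed compact_continuous_image continuous_intros)
  \<comment> \<open>Tent functions with values in the unit interval: equal to 1 on \<open>C\<close>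
    and, as \<open>C\<close> is closed, eventually 0 at each point off \<open>C\<close>.\<close>
  define F where "F n z = max 0 (1 - real n * infdist z C)" for n z
  have Fc: "continuous_on UNIV (F n)" for n
    unfolding F_def by (intro continuous_intros)
  have Fm: "(\<lambda>t. F n (cis t)) \<in> borel_measurable borel" for n
    by (intro borel_measurable_continuous_onI continuous_on_compose2[OF Fc] continuous_intros) auto
  have Fb: "\<bar>F n z\<bar> \<le> 1" for n z
    unfolding F_def using infdist_nonneg[of z C] by (auto simp: max_def)
  have lim: "(\<lambda>n. F n z) \<longlonglongrightarrow> indicator C z" for z
  proof (cases "z \<in> C")
    case True
    then show ?thesis by (simp add: F_def)
  next
    case z: False
    then have pos: "infdist z C > 0"
      using C infdist_pos_not_in_closed by blast
    obtain m :: nat where m: "1 / infdist z C < m"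
      using reals_Archimedean2 by blast
    have "F n z = 0" if "n \<ge> m" for n
    proof -
      have "1 < real m * infdist z C"
        using m pos by (simp add: field_simps)
      also have "\<dots> \<le> real n * infdist z C"
        using that pos by (intro mult_right_mono) auto
      finally show ?thesis
        by (simp add: F_def)
    qed
    then have "\<forall>\<^sub>F n in sequentially. F n z = indicator C z"
      using z by (auto simp: eventually_sequentially)
    then show ?thesis
      by (rule tendsto_eventually)
  qed
  have ind: "indicator (cis -` C) t = (indicator C (cis t) :: real)" for t
    by (auto split: split_indicator)
  have Cm: "(\<lambda>t. indicator C (cis t) :: real) \<in> borel_measurable borel"
    by (rule measurable_compose[OF borel_measurable_cis]) (use C in auto)
  have conv: "(\<lambda>n. LINT t|P. F n (cis t) * u t) \<longlonglongrightarrow> (LINT t|P. indicator C (cis t) * u t)"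
    if P: "\<And>f :: real \<Rightarrow> real. f \<in> borel_measurable borel \<Longrightarrow> f \<in> borel_measurable P" and u: "integrable P u" for P u
  proof (rule integral_dominated_convergence[where w = "\<lambda>t. \<bar>u t\<bar>"])
    show "(\<lambda>t. indicator C (cis t) * u t) \<in> borel_measurable P"
      "\<And>n. (\<lambda>t. F n (cis t) * u t) \<in> borel_measurable P"
      using P[OF Cm] P[OF Fm] u by auto
    show "AE t in P. (\<lambda>n. F n (cis t) * u t) \<longlonglongrightarrow> indicator C (cis t) * u t"
      by (intro AE_I2 tendsto_mult_right lim)
    show "AE t in P. norm (F n (cis t) * u t) \<le> \<bar>u t\<bar>" for n
    proof (intro AE_I2)
      fix t
      show "norm (F n (cis t) * u t) \<le> \<bar>u t\<bar>"
        using mult_right_mono[OF Fb[of n "cis t"], of "\<bar>u t\<bar>"] by (simp add: abs_mult)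
    qed
  qed (use u in auto)
  have "(\<lambda>n. (LINT t|M. F n (cis t) * v t) + (LINT t|N. F n (cis t) * w t)) \<longlonglongrightarrow>
      (LINT t|M. indicator C (cis t) * v t) + (LINT t|N. indicator C (cis t) * w t)"
    by (intro tendsto_add conv borel_measurable_M_N M N)
  then show ?thesis
    unfolding ind C_def[symmetric] using continuous_pairing_eq_0[OF Fc] by (simp add: LIMSEQ_const_iff)
qed simp

end

text \<open>The measure lives on \<open>T\<close>, the part of the Lebesgue null set
  \<open>S\<close> in one period. For compact \<open>K\<close> inside \<open>T\<close> the pairing
  identity expresses the mass of its periodic extension as an integral of \<open>w\<close> over a
  Lebesgue null part of the period, which is 0. Inner regularity extends this to
  \<open>T\<close>.\<close>

lemma singular_measure_eq_0:
  fixes \<mu> :: "real measure" and w :: "real \<Rightarrow> real"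
  assumes \<mu>: "sets \<mu> = sets borel" "finite_measure \<mu>" "emeasure \<mu> (UNIV - {0..<2*pi}) = 0"
    and S: "S \<in> sets borel" "emeasure lborel S = 0" "emeasure \<mu> (UNIV - S) = 0"
    and w: "integrable lborel w" "\<And>t. t \<notin> {0..2*pi} \<Longrightarrow> w t = 0"
    and fourier: "\<And>j. fourier_coeff \<mu> (\<lambda>_. 1) j + fourier_coeff lborel w j = 0"
  shows "emeasure \<mu> UNIV = 0"
proof -
  interpret finite_measure \<mu> by fact
  have sp: "space \<mu> = UNIV"
    using sets_eq_imp_space_eq[OF \<mu>(1)] by simp
  define T where "T = S \<inter> {0..<2*pi}"
  have T: "T \<in> sets borel"
    unfolding T_def using S by simp
  have K0: "emeasure \<mu> K = 0" if K: "compact K" "K \<subseteq> T" for K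
  proof -
    define P where "P = cis -` cis ` K"
    have "closed (cis ` K)"
      using K by (intro compact_imp_closed compact_continuous_image continuous_intros)
    then have "closed P"
      unfolding P_def by (intro closed_vimage continuous_intros)
    then have P: "P \<in> sets \<mu>"
      using \<mu>(1) by simp
    have "(LINT t|\<mu>. indicator P t * 1) + (LINT t|lborel. indicator P t * w t) = 0"
      unfolding P_def using \<mu> w fourier K by (intro compact_pairing_eq_0) auto
    moreover have "(LINT t|lborel. indicator P t * w t) = 0"
    proof (rule integral_eq_zero_AE)
      have "S \<in> null_sets lborel"
        using S by auto
      then have "AE t in lborel. t \<notin> S"
        by (rule AE_not_in)
      \<comment> \<open>The point \<open>2*pi\<close> is discarded: it lies in \<open>P\<close> when
        \<open>0\<close> is in \<open>K\<close>, and \<open>w\<close> may be nonzero there.\<close>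
      with AE_lborel_singleton[of "2*pi"] show "AE t in lborel. indicator P t * w t = 0"
      proof eventually_elim
        case (elim t)
        \<comment> \<open>On the half-open period \<open>cis\<close> is injective, so there
          \<open>P\<close> contains only points of \<open>K\<close>, all of them in
          \<open>S\<close>.\<close>
        have "t \<notin> P" if t: "t \<in> {0..<2*pi}"
        proof
          assume "t \<in> P"
          then obtain s where s: "s \<in> K" "cis t = cis s"
            by (auto simp: P_def)
          then have "s \<in> {0..<2*pi}" "s \<in> S"
            using K by (auto simp: T_def)
          then have "t = s"
            using t s by (intro cis_eq_near_imp_eq) auto
          with elim \<open>s \<in> S\<close> show False
            by simp
        qed
        with elim w(2)[of t] show ?case
          by (cases "t \<in> {0..<2*pi}") auto
      qed
    qed
    ultimately have "measure \<mu> P = 0"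
      using sp by simp
    then have "emeasure \<mu> P = 0"
      by (simp add: emeasure_eq_measure)
    moreover have "K \<subseteq> P"
      by (auto simp: P_def)
    ultimately show ?thesis
      using emeasure_mono[OF _ P] by (metis le_zero_eq)
  qed
  have "emeasure \<mu> T = (SUP K\<in>{K. K \<subseteq> T \<and> compact K}. emeasure \<mu> K)"
    by (rule inner_regular) (use \<mu> T sp emeasure_finite in auto)
  also have "\<dots> = 0"
    using K0 by (intro antisym SUP_least) auto
  finally have "T \<in> null_sets \<mu>"
    using T \<mu>(1) by auto
  moreover have "UNIV - S \<in> null_sets \<mu>" "UNIV - {0..<2*pi} \<in> null_sets \<mu>"
    using S \<mu> by auto
  ultimately have "T \<union> (UNIV - S) \<union> (UNIV - {0..<2*pi}) \<in> null_sets \<mu>"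
    by auto
  also have "T \<union> (UNIV - S) \<union> (UNIV - {0..<2*pi}) = UNIV"
    by (auto simp: T_def)
  finally show ?thesis
    by auto
qed

subsection \<open>Singular inner functions\<close>

lemma singular_innerE:
  assumes "singular_inner s"
  obtains c \<mu> S where "cmod c = 1" "sets \<mu> = sets borel" "finite_measure \<mu>"
    "emeasure \<mu> (UNIV - {0..<2*pi}) = 0" "S \<in> sets borel" "emeasure lborel S = 0" "emeasure \<mu> (UNIV - S) = 0"
    "\<And>z. z \<in> ball 0 1 \<Longrightarrow> s z = c * exp (- herglotz \<mu> (\<lambda>_. 1) z)"
  using assms unfolding singular_inner_def herglotz_def by auto

lemma singular_inner_holomorphic: "singular_inner s \<Longrightarrow> s holomorphic_on ball 0 1"
proof (elim singular_innerE)
  fix c \<mu> assume "sets \<mu> = sets borel" "finite_measure \<mu>"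
    "\<And>z. z \<in> ball 0 1 \<Longrightarrow> s z = c * exp (- herglotz \<mu> (\<lambda>_. 1) z)"
  then show ?thesis
    by (subst holomorphic_cong[OF refl, where g = "\<lambda>z. c * exp (- herglotz \<mu> (\<lambda>_. 1) z)"])
       (auto intro!: holomorphic_intros holomorphic_on_herglotz simp: finite_measure.integrable_const)
qed

lemma singular_inner_nonzero: "singular_inner s \<Longrightarrow> z \<in> ball 0 1 \<Longrightarrow> s z \<noteq> 0"
  by (elim singular_innerE) auto

text \<open>The null measure represents the trivial singular factor used to exhibit a
  factorization.\<close>

lemma singular_inner_one: "singular_inner (\<lambda>_. 1)"
  unfolding singular_inner_def
  by (rule exI[of _ 1], rule exI[of _ "null_measure borel"])
     (auto intro!: finite_measureI)

text \<open>Equating the two representations makes the exponential of a sum of Herglotz integrals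
  equal to the unimodular constant \<open>c / d\<close>. The Fourier coefficients then cancel, the
  singular measure vanishes, and only the constant \<open>c\<close> is left.\<close>

lemma singular_outer_imp_const:
  assumes "singular_inner s" "outer_fun s"
  obtains c where "cmod c = 1" "\<And>z. z \<in> ball 0 1 \<Longrightarrow> s z = c"
proof -
  obtain c \<mu> S where \<mu>: "cmod c = 1" "sets \<mu> = sets borel" "finite_measure \<mu>"
    "emeasure \<mu> (UNIV - {0..<2*pi}) = 0" "S \<in> sets borel" "emeasure lborel S = 0" "emeasure \<mu> (UNIV - S) = 0"
    "\<And>z. z \<in> ball 0 1 \<Longrightarrow> s z = c * exp (- herglotz \<mu> (\<lambda>_. 1) z)"
    using singular_innerE[OF assms(1)] by blast
  obtain d w where w: "cmod d = 1" "integrable lborel w" "\<And>t. t \<notin> {0..2*pi} \<Longrightarrow> w t = 0"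
    "\<And>z. z \<in> ball 0 1 \<Longrightarrow> s z = d * exp (herglotz lborel w z)"
    using outer_funE[OF assms(2)] by blast
  have int: "integrable \<mu> (\<lambda>_. 1 :: real)"
    using \<mu>(3) by (simp add: finite_measure.integrable_const)
  have nz: "c \<noteq> 0" "d \<noteq> 0"
    using \<mu>(1) w(1) by auto
  have "exp (herglotz \<mu> (\<lambda>_. 1) z + herglotz lborel w z) = c / d" if "z \<in> ball 0 1" for z
    using \<mu>(8)[OF that] w(4)[OF that] nz by (simp add: exp_add exp_minus field_simps)
  moreover have "cmod (c / d) = 1"
    using \<mu>(1) w(1) by (simp add: norm_divide)
  ultimately have "fourier_coeff \<mu> (\<lambda>_. 1) j + fourier_coeff lborel w j = 0" for j
    using \<mu>(2) int w(2) by (intro fourier_coeff_eq_0_of_exp_const[where c = "c / d"]) auto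
  then have "emeasure \<mu> UNIV = 0"
    using \<mu> w by (intro singular_measure_eq_0[of \<mu> S w]) auto
  then have "UNIV \<in> null_sets \<mu>"
    using \<mu>(2) by auto
  then have "herglotz \<mu> (\<lambda>_. 1) z = 0" for z
    unfolding herglotz_def by (intro integral_eq_zero_AE AE_I') auto
  with \<mu> that show thesis
    by simp
qed

subsection \<open>Uniqueness of the factorization\<close>

text \<open>Restores an identity at the zero of a Blaschke factor after that factor has been
  cancelled.\<close>

lemma continuous_on_ball_eq_except:
  fixes f g :: "complex \<Rightarrow> complex"
  assumes "continuous_on (ball 0 1) f" "continuous_on (ball 0 1) g"
    and eq: "\<And>z. z \<in> ball 0 1 \<Longrightarrow> z \<noteq> a \<Longrightarrow> f z = g z" and a: "a \<in> ball 0 1"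
  shows "f a = g a"
proof -
  have "(f \<longlongrightarrow> f a) (at a)" "(g \<longlongrightarrow> g a) (at a)"
    using assms by (simp_all add: continuous_on_eq_continuous_at isCont_def)
  moreover have "\<forall>\<^sub>F z in at a. f z = g z"
  proof -
    have "\<forall>\<^sub>F z in at a. z \<in> ball 0 1 - {a}"
      using a by (intro eventually_at_in_open) auto
    then show ?thesis
      by eventually_elim (use eq in auto)
  qed
  ultimately show ?thesis
    using tendsto_unique[OF trivial_limit_at] tendsto_cong by metis
qed

text \<open>Since \<open>g\<close> and \<open>h\<close> have no zeros, a zero listed in
  \<open>M\<close> must be listed in \<open>N\<close>. Cancelling one common factor at a time
  accounts for multiplicities.\<close>

lemma finite_blaschke_factorization_unique:
  assumes "set_mset M \<subseteq> ball 0 1" "set_mset N \<subseteq> ball 0 1"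
    and cont: "continuous_on (ball 0 1) g" "continuous_on (ball 0 1) h"
    and nz: "\<And>z. z \<in> ball 0 1 \<Longrightarrow> g z \<noteq> 0" "\<And>z. z \<in> ball 0 1 \<Longrightarrow> h z \<noteq> 0"
    and "\<And>z. z \<in> ball 0 1 \<Longrightarrow> finite_blaschke M z * g z = finite_blaschke N z * h z"
  shows "M = N \<and> (\<forall>z\<in>ball 0 1. g z = h z)"
  using assms(1,2,7)
proof (induction M arbitrary: N)
  case empty
  have "a \<notin># N" for a
  proof
    assume "a \<in># N"
    then have "a \<in> ball 0 1" "finite_blaschke N a = 0"
      using empty.prems(2) finite_blaschke_eq_0_iff[of N a] by blast+
    with empty.prems(3)[of a] nz(1)[of a] show False
      by auto
  qed
  then have "N = {#}"
    by (metis multiset_nonemptyE)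
  with empty.prems(3) show ?case
    by simp
next
  case (add a M)
  have a: "a \<in> ball 0 1"
    using add.prems(1) by simp
  have "finite_blaschke (add_mset a M) a = 0"
    using add.prems(1) a by (subst finite_blaschke_eq_0_iff) auto
  then have "finite_blaschke N a = 0"
    using add.prems(3)[OF a] nz(2)[OF a] by (metis mult_eq_0_iff)
  then have "a \<in># N"
    using add.prems(2) a by (simp add: finite_blaschke_eq_0_iff)
  then obtain N' where N: "N = add_mset a N'"
    by (metis insert_DiffM)
  have MN: "set_mset M \<subseteq> ball 0 1" "set_mset N' \<subseteq> ball 0 1"
    using add.prems N by auto
  \<comment> \<open>The cancelled factor vanishes at \<open>a\<close>, so division is possible only
    elsewhere.\<close>
  have off: "finite_blaschke M z * g z = finite_blaschke N' z * h z" if "z \<in> ball 0 1" "z \<noteq> a" for z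
    using add.prems(3)[OF that(1)] that a by (simp add: N mult.assoc blaschke_factor_eq_0_iff)
  have cb: "continuous_on (ball 0 1) (finite_blaschke K)" if "set_mset K \<subseteq> ball 0 1" for K
    by (rule continuous_on_subset[OF continuous_on_finite_blaschke[OF that]]) auto
  have "finite_blaschke M a * g a = finite_blaschke N' a * h a"
    by (rule continuous_on_ball_eq_except[OF _ _ off a]) (intro continuous_intros cb MN cont)+
  with off have "finite_blaschke M z * g z = finite_blaschke N' z * h z" if "z \<in> ball 0 1" for z
    using that by (cases "z = a") auto
  from add.IH[OF MN this] show ?case
    by (simp add: N)
qed

lemma blaschke_product_finite_blaschke:
  assumes "set_mset M \<subseteq> ball 0 1"
  shows "blaschke_product (finite_blaschke M)"
proof -
  obtain xs where xs: "mset xs = M"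
    using ex_mset by blast
  \<comment> \<open>Zeros are indexed by an infinite sequence; the padding value 0 lies in the disc
    and never enters the finite product.\<close>
  define a where "a k = (if k < length xs then xs ! k else 0)" for k
  have "a k \<in> ball 0 1" for k
    using assms xs by (auto simp: a_def) (metis assms mem_ball_0 nth_mem_mset subsetD)
  moreover have "finite_blaschke M z = (\<Prod>k<length xs. blaschke_factor (a k) z)" for z
  proof -
    have "finite_blaschke M z = prod_list (map (\<lambda>b. blaschke_factor b z) xs)"
      by (simp add: finite_blaschke_def flip: xs prod_mset_prod_list)
    also have "\<dots> = (\<Prod>k<length xs. blaschke_factor (xs ! k) z)"
      by (simp add: prod.list_conv_set_nth atLeast0LessThan)
    finally show ?thesis
      by (simp add: a_def)
  qed
  ultimately show ?thesis
    unfolding blaschke_product_def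
    by (intro exI[of _ 1] exI[of _ a] conjI disjI1 exI[of _ "length xs"]) auto
qed

text \<open>An infinite product is excluded: each \<open>a k\<close> is a zero, so the sequence has
  finitely many values and its moduli stay below some \<open>m < 1\<close>. Then
  \<open>1 - cmod (a k)\<close> cannot tend to 0, against summability.\<close>

lemma blaschke_product_finite_zeros:
  assumes "blaschke_product \<phi>" and fin: "finite {z\<in>ball 0 1. \<phi> z = 0}"
  obtains c N where "cmod c = 1" "set_mset N \<subseteq> ball 0 1"
    "\<And>z. z \<in> ball 0 1 \<Longrightarrow> \<phi> z = c * finite_blaschke N z"
proof -
  obtain c a where c: "cmod c = 1" and a: "\<And>k. a k \<in> ball 0 1" and
    cases: "(\<exists>n::nat. \<forall>z\<in>ball 0 1. \<phi> z = c * (\<Prod>k<n. blaschke_factor (a k) z)) \<or>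
      (summable (\<lambda>k. 1 - cmod (a k)) \<and>
       (\<forall>z\<in>ball 0 1. (\<lambda>k. blaschke_factor (a k) z) has_prod (\<phi> z / c)))"
    using assms(1) unfolding blaschke_product_def by (elim exE conjE) (rule that, assumption, erule spec)
  from cases show thesis
  proof (elim disjE exE conjE)
    fix n assume "\<forall>z\<in>ball 0 1. \<phi> z = c * (\<Prod>k<n. blaschke_factor (a k) z)"
    then show thesis
      using c a by (intro that[of c "image_mset a (mset_set {..<n})"])
        (auto simp: finite_blaschke_def prod_unfold_prod_mset image_mset.compositionality o_def)
  next
    assume su: "summable (\<lambda>k. 1 - cmod (a k))"
      and pr: "\<forall>z\<in>ball 0 1. (\<lambda>k. blaschke_factor (a k) z) has_prod (\<phi> z / c)"
    have zero: "\<phi> (a k) = 0" for k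
    proof -
      have "(\<lambda>j. blaschke_factor (a j) (a k)) has_prod (\<phi> (a k) / c)"
        using pr a by blast
      moreover have "blaschke_factor (a k) (a k) = 0"
        using a by (simp add: blaschke_factor_eq)
      ultimately have "\<phi> (a k) / c = 0"
        by (rule has_prod_zeroI)
      with c show ?thesis by auto
    qed
    have "range a \<subseteq> {z\<in>ball 0 1. \<phi> z = 0}"
      using zero a by auto
    then have f: "finite (range a)"
      using fin by (rule finite_subset)
    define m where "m = Max ((\<lambda>z. cmod z) ` range a)"
    have "m \<in> cmod ` range a"
      unfolding m_def using f by (intro Max_in) auto
    then have m: "m < 1"
      using a by auto
    have le: "cmod (a k) \<le> m" for k
      unfolding m_def using f by (intro Max_ge) auto
    have "(\<lambda>k. 1 - cmod (a k)) \<longlonglongrightarrow> 0"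
      using su by (rule summable_LIMSEQ_zero)
    then have "1 - m \<le> 0"
      by (rule LIMSEQ_le_const) (use le in auto)
    with m show thesis
      by simp
  qed
qed

text \<open>As \<open>mean_freq\<close> is a definite description, every factorization has to give
  the same number. The given one takes the singular factor 1; in any other the Blaschke factors
  coincide and the singular factor is constant.\<close>

theorem mean_freq_finite_blaschke_outer:
  assumes M: "set_mset M \<subseteq> ball 0 1" and u: "outer_fun u"
    and f: "\<And>z. z \<in> ball 0 1 \<Longrightarrow> f z = finite_blaschke M z * u z"
  shows "mean_freq f = size M"
  unfolding mean_freq_def
proof (rule the_equality)
  have "phase_freq (finite_blaschke M) = size M"
    by (rule phase_freq_finite_blaschke[OF M, of 1]) auto
  moreover have "phase_freq (\<lambda>_. 1) = 0"
    using phase_freq_finite_blaschke[of "{#}" 1 "\<lambda>_. 1"] by simp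
  ultimately show "\<exists>\<phi> s u. blaschke_product \<phi> \<and> singular_inner s \<and> outer_fun u \<and>
      (\<forall>z\<in>ball 0 1. f z = \<phi> z * s z * u z) \<and> real (size M) = phase_freq \<phi> + phase_freq s"
    using blaschke_product_finite_blaschke[OF M] singular_inner_one u f
    by (intro exI[of _ "finite_blaschke M"] exI[of _ "\<lambda>_. 1"] exI[of _ u]) auto
next
  fix m assume "\<exists>\<phi> s u. blaschke_product \<phi> \<and> singular_inner s \<and> outer_fun u \<and>
      (\<forall>z\<in>ball 0 1. f z = \<phi> z * s z * u z) \<and> m = phase_freq \<phi> + phase_freq s"
  then obtain \<phi> s v where \<phi>: "blaschke_product \<phi>" and s: "singular_inner s" and v: "outer_fun v"
    and fact: "\<And>z. z \<in> ball 0 1 \<Longrightarrow> f z = \<phi> z * s z * v z" and m: "m = phase_freq \<phi> + phase_freq s"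
    by blast
  have "{z\<in>ball 0 1. \<phi> z = 0} \<subseteq> set_mset M"
  proof safe
    fix z assume z: "z \<in> ball 0 1" "\<phi> z = 0"
    then have "finite_blaschke M z * u z = 0"
      using fact[of z] f[of z] by simp
    with z show "z \<in># M"
      using outer_fun_nonzero[OF u z(1)] M by (simp add: finite_blaschke_eq_0_iff)
  qed
  then have "finite {z\<in>ball 0 1. \<phi> z = 0}"
    by (rule finite_subset) simp
  then obtain c N where N: "cmod c = 1" "set_mset N \<subseteq> ball 0 1"
    "\<And>z. z \<in> ball 0 1 \<Longrightarrow> \<phi> z = c * finite_blaschke N z"
    using blaschke_product_finite_zeros[OF \<phi>] by blast
  \<comment> \<open>The factors \<open>c\<close>, \<open>s\<close> and \<open>v\<close> are
    collected into one zero-free function, to be compared with \<open>u\<close>.\<close>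
  have "M = N \<and> (\<forall>z\<in>ball 0 1. u z = c * s z * v z)"
  proof (rule finite_blaschke_factorization_unique[OF M N(2)])
    show "continuous_on (ball 0 1) u" "continuous_on (ball 0 1) (\<lambda>z. c * s z * v z)"
      by (intro continuous_intros holomorphic_on_imp_continuous_on outer_fun_holomorphic
          singular_inner_holomorphic u v s)+
    show "u z \<noteq> 0" "c * s z * v z \<noteq> 0" if "z \<in> ball 0 1" for z
      using outer_fun_nonzero[OF u that] outer_fun_nonzero[OF v that] singular_inner_nonzero[OF s that] N(1)
      by auto
    show "finite_blaschke M z * u z = finite_blaschke N z * (c * s z * v z)" if "z \<in> ball 0 1" for z
      using f[OF that] fact[OF that] N(3)[OF that] by (simp add: mult_ac)
  qed
  then have "M = N" and uz: "\<And>z. z \<in> ball 0 1 \<Longrightarrow> u z = c * s z * v z"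
    by auto
  have "c \<noteq> 0"
    using N(1) by auto
  \<comment> \<open>Solving \<open>u = c * s * v\<close> for \<open>s\<close> shows the singular
    factor to be a quotient of outer functions.\<close>
  have "outer_fun s"
  proof (rule outer_fun_divide[OF u v])
    show "cmod (1 / c) = 1"
      using N(1) by (simp add: norm_divide)
    show "s z = 1 / c * u z / v z" if "z \<in> ball 0 1" for z
      using uz[OF that] outer_fun_nonzero[OF v that] \<open>c \<noteq> 0\<close> by simp
  qed
  then obtain d where "cmod d = 1" "\<And>z. z \<in> ball 0 1 \<Longrightarrow> s z = d"
    using singular_outer_imp_const[OF s] by blast
  then have "phase_freq s = 0"
    using phase_freq_finite_blaschke[of "{#}" d s] by simp
  moreover have "phase_freq \<phi> = size N"
    using N by (intro phase_freq_finite_blaschke) auto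
  ultimately show "m = size M"
    using m \<open>M = N\<close> by simp
qed

subsection \<open>Szego kernels and Takenaka-Malmquist functions\<close>

text \<open>The power \<open>z ^ n\<close> is the Blaschke product with an \<open>n\<close>-fold
  zero at 0, and the rest is outer. An arbitrary nonzero \<open>C\<close> covers the kernel and its
  normalization together.\<close>

lemma mean_freq_power_szego:
  assumes "C \<noteq> 0" "a \<in> ball 0 1"
  shows "mean_freq (\<lambda>z. C * z ^ n / (1 - cnj a * z) ^ k) = n"
proof -
  have b: "finite_blaschke (replicate_mset n 0) z = z ^ n" for z
    by (induction n) (simp_all add: blaschke_factor_def)
  have "mean_freq (\<lambda>z. C * z ^ n / (1 - cnj a * z) ^ k) = size (replicate_mset n (0::complex))"
    by (rule mean_freq_finite_blaschke_outer[where u = "\<lambda>z. C / (1 - cnj a * z) ^ k"])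
       (use assms in \<open>auto intro!: outer_fun_szego simp: b split: if_splits\<close>)
  then show ?thesis by simp
qed

text \<open>Ensures that normalization divides by a nonzero number. A real supremum says something
  only for a bounded family, so an upper bound for all means is needed as well as a positive lower
  bound for one of them.\<close>

lemma hardy2_norm_szego_pos:
  assumes a: "a \<in> ball 0 1"
  shows "hardy2_norm (szego_kernel n a) > 0"
proof -
  define I where "I r = (1 / (2*pi)) * (LINT t:{0..2*pi}|lborel. (cmod (szego_kernel n a (of_real r * cis t)))\<^sup>2)" for r :: real
  \<comment> \<open>\<open>B\<close> comes from
    \<open>cmod (1 - cnj a * z) \<ge> 1 - cmod a\<close>; \<open>b\<close> comes from
    \<open>cmod (1 - cnj a * z) \<le> 2\<close> at radius \<open>1/2\<close>.\<close>
  define B where "B = (fact n / (1 - cmod a) ^ (n + 1))\<^sup>2"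
  define b where "b = (fact n * (1/2) ^ n / 2 ^ (n + 1) :: real)\<^sup>2"
  have a1: "cmod a < 1"
    using a by simp
  have norm_eq: "cmod (szego_kernel n a z) = fact n * cmod z ^ n / cmod (1 - cnj a * z) ^ (n + 1)" for z
    by (simp add: szego_kernel_def norm_mult norm_divide norm_power)
  have int: "set_integrable lborel {0..2*pi} (\<lambda>t. (cmod (szego_kernel n a (of_real r * cis t)))\<^sup>2)"
    if r: "r \<in> {0<..<1}" for r
    unfolding szego_kernel_def using one_minus_mult_nonzero[OF a1, of "of_real r * cis _"] r
    by (intro borel_integrable_atLeastAtMost' continuous_intros) (auto simp: norm_mult)
  have const: "(LINT t:{0..2*pi}|lborel. x) = 2 * pi * x" for x :: real
    by (simp add: set_integral_const)
  have "I r \<le> B" if r: "r \<in> {0<..<1}" for r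
  proof -
    have "(LINT t:{0..2*pi}|lborel. (cmod (szego_kernel n a (of_real r * cis t)))\<^sup>2) \<le> (LINT t:{0..2*pi}|lborel. B)"
    proof (rule set_integral_mono[OF int[OF r]])
      show "set_integrable lborel {0..2*pi} (\<lambda>t. B)"
        by (intro borel_integrable_atLeastAtMost' continuous_intros)
      fix t
      have "cmod (cnj a * (of_real r * cis t)) \<le> cmod a"
        using r by (simp add: norm_mult mult_left_le)
      then have "1 - cmod a \<le> cmod (1 - cnj a * (of_real r * cis t))"
        using norm_triangle_ineq2[of 1 "cnj a * (of_real r * cis t)"] by simp
      then have "cmod (szego_kernel n a (of_real r * cis t)) \<le> fact n / (1 - cmod a) ^ (n + 1)"
        unfolding norm_eq using a1 r
        by (intro frac_le power_mono) (auto simp: norm_mult power_le_one mult_left_le)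
      then show "(cmod (szego_kernel n a (of_real r * cis t)))\<^sup>2 \<le> B"
        unfolding B_def by (intro power_mono) auto
    qed
    then show ?thesis
      unfolding I_def const by (simp add: field_simps)
  qed
  then have bdd: "bdd_above (I ` {0<..<1})"
    by (rule bdd_aboveI2)
  have "b \<le> I (1/2)"
  proof -
    have "(LINT t:{0..2*pi}|lborel. b) \<le> (LINT t:{0..2*pi}|lborel. (cmod (szego_kernel n a (of_real (1/2) * cis t)))\<^sup>2)"
    proof (rule set_integral_mono[OF _ int])
      show "set_integrable lborel {0..2*pi} (\<lambda>t. b)"
        by (intro borel_integrable_atLeastAtMost' continuous_intros)
      fix t
      define q where "q = cnj a * (of_real (1/2) * cis t)"
      have "cmod q \<le> 1"
        using a1 by (simp add: q_def norm_mult)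
      then have "cmod (1 - q) \<le> 2"
        using norm_triangle_ineq4[of 1 q] by simp
      moreover have "cmod (1 - q) > 0"
        using one_minus_mult_nonzero[OF a1, of "of_real (1/2) * cis t"] by (simp add: q_def norm_mult)
      ultimately have "fact n * (1/2) ^ n / 2 ^ (n + 1) \<le> cmod (szego_kernel n a (of_real (1/2) * cis t))"
        unfolding norm_eq q_def[symmetric]
        by (intro frac_le power_mono mult_left_mono) (auto simp: norm_mult)
      then show "b \<le> (cmod (szego_kernel n a (of_real (1/2) * cis t)))\<^sup>2"
        unfolding b_def by (intro power_mono) auto
    qed auto
    then show ?thesis
      unfolding I_def const by (simp add: field_simps)
  qed
  also have "I (1/2) \<le> (SUP r\<in>{0<..<1}. I r)"
    by (rule cSUP_upper[OF _ bdd]) auto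
  finally have "0 < (SUP r\<in>{0<..<1}. I r)"
    by (rule less_le_trans[rotated]) (simp add: b_def)
  then show ?thesis
    unfolding hardy2_norm_def I_def by simp
qed

lemma mean_freq_TM:
  assumes n: "n \<ge> 1" and a: "\<And>l. l \<in> {1..n} \<Longrightarrow> a l \<in> ball 0 1"
  shows "mean_freq (TM n a) = real n - 1"
proof -
  define M where "M = image_mset a (mset_set {1..<n})"
  \<comment> \<open>Dividing by the rotations compensates for replacing the plain Moebius factors by
    normalized Blaschke factors. The point \<open>a n\<close> enters only the outer factor, which
    leaves \<open>n - 1\<close> zeros.\<close>
  define C where "C = of_real (sqrt (1 - (cmod (a n))\<^sup>2)) / (\<Prod>l\<in>{1..<n}. blaschke_rotation (a l))"
  have an: "cmod (a n) < 1"
    using a[of n] n by simp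
  have rot: "blaschke_rotation x \<noteq> 0" for x
    using norm_blaschke_rotation[of x] by force
  have "(cmod (a n))\<^sup>2 \<noteq> 1"
    using an power2_eq_1_iff[of "cmod (a n)"] norm_ge_zero[of "a n"] by linarith
  then have C: "C \<noteq> 0"
    using rot by (auto simp: C_def)
  have "mean_freq (TM n a) = size M"
  proof (rule mean_freq_finite_blaschke_outer[OF _ outer_fun_szego[OF C an, of 1]])
    show "set_mset M \<subseteq> ball 0 1"
      unfolding M_def using a by fastforce
    fix z :: complex
    have "finite_blaschke M z = (\<Prod>l\<in>{1..<n}. blaschke_factor (a l) z)"
      by (simp add: M_def finite_blaschke_def prod_unfold_prod_mset image_mset.compositionality o_def)
    also have "\<dots> = (\<Prod>l\<in>{1..<n}. blaschke_rotation (a l)) * (\<Prod>l\<in>{1..<n}. (z - a l) / (1 - cnj (a l) * z))"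
      unfolding blaschke_factor_eq by (rule prod.distrib)
    finally show "TM n a z = finite_blaschke M z * (C / (1 - cnj (a n) * z) ^ 1)"
      using rot by (simp add: TM_def C_def)
  qed
  then show ?thesis
    using n by (simp add: M_def of_nat_diff)
qed

theorem theorem1:
  shows "(\<forall>(n::nat) (a::complex). a \<in> ball 0 1 \<longrightarrow>
            mean_freq (szego_kernel n a) = real n \<and>
            mean_freq (szego_normalized n a) = real n) \<and>
         (\<forall>(n::nat) (a::nat \<Rightarrow> complex). n \<ge> 1 \<longrightarrow> (\<forall>l\<in>{1..n}. a l \<in> ball 0 1) \<longrightarrow>
            mean_freq (TM n a) = real n - 1)"
proof (intro conjI allI impI)
  fix n :: nat and a :: complex assume a: "a \<in> ball 0 1"
  show "mean_freq (szego_kernel n a) = real n"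
    using mean_freq_power_szego[OF _ a, of "of_nat (fact n)" n "n + 1"] unfolding szego_kernel_def[abs_def] by simp
  \<comment> \<open>Normalization only changes the constant in front, and that constant is nonzero
    because the norm is positive.\<close>
  have "szego_normalized n a =
      (\<lambda>z. (of_nat (fact n) / of_real (hardy2_norm (szego_kernel n a))) * z ^ n / (1 - cnj a * z) ^ (n + 1))"
    by (simp add: szego_normalized_def[abs_def] szego_kernel_def mult_ac)
  then show "mean_freq (szego_normalized n a) = real n"
    using hardy2_norm_szego_pos[OF a, of n] by (simp only:) (intro mean_freq_power_szego a, simp)
next
  fix n :: nat and a :: "nat \<Rightarrow> complex"
  assume "n \<ge> 1" "\<forall>l\<in>{1..n}. a l \<in> ball 0 1"
  then show "mean_freq (TM n a) = real n - 1"
    by (intro mean_freq_TM) auto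
qed

end
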